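(* Let $q>1$ and $A>0$, and set $\alpha=q/(q-1)$ and $c(A,q)=\tfrac12\big(A(4q-2)/q\big)^q$. The problem of maximizing $\det\mathscr{T}_V$ over real-valued $V\in L^q[0,1]$ with $\|V\|_{L^q}\le A$ has a unique solution $V_A$. It is given by \[ V_A=\frac{q}{4q-2}\,\Psi^{1/(q-1)}, \] where $\Psi$ solves \[ \Psi''-|\Psi|^\alpha+2H=0,\qquad \Psi(0)=0,\qquad \Psi'(0)=H-c(A,q), \] for a uniquely determined constant $H>c(A,q)$. The function $\Psi$ is non-negative on $[0,1]$. The potential $V_A$ has the following properties: - it is symmetric with respect to $t=1/2$; - it is smooth on $(0,1)$; - it is strictly increasing on $[0,1/2]$. Its behaviour at the endpoints depends on $q$: - if $1<q<2$, $V_A$ has zero derivatives at $t=0$ and $t=1$; - if $q=2$, $V_A$ has a positive derivative at $t=0$ and a negative derivative at $t=1$; - if $q>2$, $V_A$ has vertical tangents at both endpoints.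
   Context: For a real-valued potential $V\in L^q[0,1]$ ($q\ge1$), let $y_V$ be the solution of $-y''+Vy=0$ on $[0,1]$ with $y(0)=0$, $y'(0)=1$. Let $\mathscr{T}_V$ be the Schrödinger operator $\phi\mapsto-\phi''+V\phi$ on $[0,1]$ with Dirichlet conditions $\phi(0)=\phi(1)=0$. Its functional determinant is $\det\mathscr{T}_V=2y_V(1)$. For non-negative $V$ this coincides with the zeta-regularized determinant $e^{-\zeta'_{\mathscr{T}_V}(0)}$, where $\zeta_{\mathscr{T}_V}(s)=\sum_n\lambda_n^{-s}$ over the Dirichlet eigenvalues $\lambda_n$, meromorphically continued. For general $V$, $2y_V(1)$ is the continuous extension of this determinant. *)

theory Defs
  imports "HOL-Analysis.Analysis"
begin

definition Lq_on01 :: "real \<Rightarrow> (real \<Rightarrow> real) \<Rightarrow> bool" where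
  "Lq_on01 q V \<longleftrightarrow> set_borel_measurable lborel {0..1} V \<and>
     set_integrable lborel {0..1} (\<lambda>t. \<bar>V t\<bar> powr q)"

definition Lq_norm01 :: "real \<Rightarrow> (real \<Rightarrow> real) \<Rightarrow> real" where
  "Lq_norm01 q V = (LINT t:{0..1}|lborel. \<bar>V t\<bar> powr q) powr (1 / q)"

definition admissible :: "real \<Rightarrow> real \<Rightarrow> (real \<Rightarrow> real) \<Rightarrow> bool" where
  "admissible q A V \<longleftrightarrow> Lq_on01 q V \<and> Lq_norm01 q V \<le> A"

text \<open>y solves -y'' + V y = 0 on [0,1], y(0)=0, y'(0)=1, in the (Caratheodory) sense of
  the equivalent Volterra integral equation y(t) = t + int_0^t (t-s) V(s) y(s) ds.\<close>
definition y_sol :: "(real \<Rightarrow> real) \<Rightarrow> (real \<Rightarrow> real) \<Rightarrow> bool" where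
  "y_sol V y \<longleftrightarrow> continuous_on {0..1} y \<and>
     (\<forall>t\<in>{0..1}. y t = t + (LINT s:{0..t}|lborel. (t - s) * V s * y s))"

definition det_T :: "(real \<Rightarrow> real) \<Rightarrow> real" where
  "det_T V = 2 * (THE r. \<exists>y. y_sol V y \<and> y 1 = r)"

definition psi_sol :: "real \<Rightarrow> real \<Rightarrow> real \<Rightarrow> (real \<Rightarrow> real) \<Rightarrow> bool" where
  "psi_sol \<alpha> H c \<Psi> \<longleftrightarrow> (\<exists>\<Psi>'.
      (\<forall>t\<in>{0..1}. (\<Psi> has_real_derivative \<Psi>' t) (at t within {0..1}) \<and>
                   (\<Psi>' has_real_derivative (\<bar>\<Psi> t\<bar> powr \<alpha> - 2 * H)) (at t within {0..1})) \<and>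
      \<Psi> 0 = 0 \<and> \<Psi>' 0 = H - c)"

definition smooth_on :: "real set \<Rightarrow> (real \<Rightarrow> real) \<Rightarrow> bool" where
  "smooth_on S f \<longleftrightarrow> (\<forall>k. \<forall>t\<in>S. ((deriv ^^ k) f) differentiable (at t))"

end

theory Submission
  imports Defs
begin

text \<open>For \<open>V \<ge> 0\<close> the functional \<open>V \<mapsto> ln y\<^sub>V(1)\<close> is concave, so a critical point on the \<open>L\<^sup>q\<close> ball is a maximum.
  Concretely, let \<open>U = V\<^sub>A\<close>, let \<open>z\<close> be its solution and put \<open>v = \<Psi>'(0)\<close>. Energy conservation for \<open>\<Psi>\<close> gives
  \<open>2 \<Psi> z' = (\<Psi>' + v) z\<close>. Integrating by parts and completing the square in the Riccati variable \<open>y'/y\<close> then yields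
  \<open>v ln (y\<^sub>V(1) / z(1)) \<le> \<integral> \<Psi> (V - U)\<close>. Because \<open>\<Psi>\<close> is a multiple of \<open>U\<^bsup>q-1\<^esup>\<close>, the right-hand side is at most a
  multiple of \<open>\<integral> V\<^sup>q - \<integral> U\<^sup>q \<le> 0\<close>, with equality only for \<open>V = U\<close>. A sign-changing \<open>V\<close> is dominated by its absolute value.

  The profile \<open>\<Psi> = m (1 - x\<^sup>2)\<close> is found by quadrature: \<open>x\<close> solves a first-order equation whose right-hand side is
  positive and bounded away from 0, so \<open>x\<close> is the inverse of an explicit integral. The remaining parameter is fixed
  by the intermediate value theorem.\<close>

section \<open>Integration by parts and a Gronwall inequality\<close>

text \<open>The constants come from one object. If \<Psi> is the product of two solutions of
  \<open>-z'' + U z = 0\<close>, one vanishing at 0 and one at 1, then \<Psi> is up to a factor the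
  derivative of the determinant in the potential, so criticality on the sphere asks for
  \<open>U^(q-1)\<close> proportional to \<Psi>. Such a product satisfies
  \<open>\<Psi>'^2 - 2 \<Psi> \<Psi>'' + 4 U \<Psi>^2 = v^2\<close> with the Wronskian
  \<open>v\<close>. For \<open>U = k \<Psi>^(1/(q-1))\<close> this agrees with the energy law of
  \<open>\<Psi>'' = \<Psi>^\<alpha> - 2 H\<close> exactly when
  \<open>4 k = 2 \<alpha> / (\<alpha> + 1)\<close>, that is, \<open>k = q / (4 q - 2)\<close>.
  Integrating the equation over [0,1] gives 2c for the integral of \<open>\<Psi>^\<alpha>\<close>,
  and c is the value for which U has norm A. The obstacle is regularity: V is merely integrable, so
  differential identities are used in integrated form. Moreover \<open>y'/y\<close> blows up at 0
  and \<Psi> vanishes at both ends, so logarithmic identities are cut off near 0 and passed to the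
  limit. Uniqueness of H comes from \<open>VA\<close>, which determines \<Psi> and with it the slope
  at 0.\<close>

lemma has_real_derivative_0_if_abs_diff_le:
  fixes f :: "real \<Rightarrow> real"
  assumes G: "continuous_on {a..b} G" and x: "x \<in> {a..b}"
    and le: "\<And>y. y \<in> {a..b} \<Longrightarrow> \<bar>f y - f x\<bar> \<le> \<bar>y - x\<bar> * \<bar>G y - G x\<bar>"
  shows "(f has_real_derivative 0) (at x within {a..b})"
proof -
  have "((\<lambda>y. \<bar>G y - G x\<bar>) \<longlongrightarrow> \<bar>G x - G x\<bar>) (at x within {a..b})"
    using G x unfolding continuous_on_def by (intro tendsto_intros) auto
  then have *: "((\<lambda>y. \<bar>G y - G x\<bar>) \<longlongrightarrow> 0) (at x within {a..b})" by simp
  have "((\<lambda>y. (f y - f x) / (y - x)) \<longlongrightarrow> 0) (at x within {a..b})"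
  proof (rule Lim_null_comparison[OF _ *])
    show "\<forall>\<^sub>F y in at x within {a..b}. norm ((f y - f x) / (y - x)) \<le> \<bar>G y - G x\<bar>"
      unfolding eventually_at_filter
    proof (intro always_eventually allI impI)
      fix y assume "y \<noteq> x" "y \<in> {a..b}"
      with le[of y] show "norm ((f y - f x) / (y - x)) \<le> \<bar>G y - G x\<bar>"
        by (simp add: divide_simps mult.commute)
    qed
  qed
  then show ?thesis by (simp add: has_field_derivative_iff)
qed

lemma absolutely_integrable_mult_continuous:
  fixes f h :: "real \<Rightarrow> real"
  assumes "f absolutely_integrable_on {a..b}" "continuous_on {a..b} h"
  shows "(\<lambda>s. f s * h s) absolutely_integrable_on {a..b}"
proof -
  have "(\<lambda>s. h s * f s) absolutely_integrable_on {a..b}"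
    using assms continuous_imp_measurable_on_sets_lebesgue[of "{a..b}" h] compact_continuous_image[of "{a..b}" h]
    by (intro absolutely_integrable_bounded_measurable_product_real compact_imp_bounded) auto
  then show ?thesis by (simp add: mult.commute)
qed

text \<open>With \<open>f\<close> merely integrable, its primitive \<open>F\<close> need not be
  differentiable everywhere. But the defect \<open>P\<close> of the formula satisfies
  \<open>\<bar>P t - P s\<bar> \<le> 2 M (t - s) (N t - N s)\<close>, where \<open>N\<close> is the
  continuous primitive of \<open>\<bar>f\<bar>\<close> and \<open>M\<close> bounds
  \<open>\<bar>h'\<bar>\<close>; so \<open>P\<close> has derivative 0 at every point and is
  constant.\<close>

lemma integral_by_parts_absolutely_integrable:
  fixes f h h' :: "real \<Rightarrow> real"
  assumes f: "f absolutely_integrable_on {a..b}" and ab: "a \<le> b"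
    and h: "\<And>t. t \<in> {a..b} \<Longrightarrow> (h has_real_derivative h' t) (at t within {a..b})"
    and h': "continuous_on {a..b} h'"
  shows "integral {a..b} (\<lambda>s. f s * h s)
       = integral {a..b} f * h b - integral {a..b} (\<lambda>t. integral {a..t} f * h' t)"
proof -
  define F where "F = (\<lambda>t. integral {a..t} f)"
  have ch: "continuous_on {a..b} h"
    using h DERIV_continuous unfolding continuous_on_eq_continuous_within by blast
  have if_: "f integrable_on {a..b}" and ia: "(\<lambda>s. \<bar>f s\<bar>) integrable_on {a..b}"
    using f absolutely_integrable_on_def[where f = f] by auto
  have cF: "continuous_on {a..b} F"
    unfolding F_def by (rule indefinite_integral_continuous_1[OF if_])
  define N where "N = (\<lambda>t. integral {a..t} (\<lambda>s. \<bar>f s\<bar>))"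
  have cN: "continuous_on {a..b} N"
    unfolding N_def by (rule indefinite_integral_continuous_1[OF ia])
  have "(\<lambda>s. f s * h s) absolutely_integrable_on {a..b}"
    by (rule absolutely_integrable_mult_continuous[OF f ch])
  then have ifh: "(\<lambda>s. f s * h s) integrable_on {a..b}"
    by (simp add: absolutely_integrable_on_def)
  have iFh: "(\<lambda>s. F s * h' s) integrable_on {a..b}"
    by (intro integrable_continuous_real continuous_intros cF h')
  define P where "P = (\<lambda>t. F t * h t - integral {a..t} (\<lambda>s. f s * h s) - integral {a..t} (\<lambda>s. F s * h' s))"
  have "compact (h' ` {a..b})" using h' by (intro compact_continuous_image) auto
  then obtain M where M: "\<And>t. t \<in> {a..b} \<Longrightarrow> \<bar>h' t\<bar> \<le> M" "M \<ge> 0"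
    using compact_imp_bounded bounded_pos[of "h' ` {a..b}"] by (metis image_eqI less_imp_le real_norm_def)
  have hl: "\<bar>h y - h x\<bar> \<le> M * \<bar>y - x\<bar>" if "x \<in> {a..b}" "y \<in> {a..b}" for x y
  proof -
    have "norm (h y - h x) \<le> M * norm (y - x)"
      using that M h by (intro field_differentiable_bound[where S = "{a..b}" and f' = h']) auto
    then show ?thesis by simp
  qed
  have key: "\<bar>P t - P s\<bar> \<le> (t - s) * \<bar>2 * M * N t - 2 * M * N s\<bar>" if st: "a \<le> s" "s \<le> t" "t \<le> b" for s t
  proof -
    have sub: "{s..t} \<subseteq> {a..b}" "{a..t} \<subseteq> {a..b}" "{a..s} \<subseteq> {a..b}" using st by auto
    note int = integrable_on_subinterval[OF if_ sub(1)] integrable_on_subinterval[OF ifh sub(1)]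
      integrable_on_subinterval[OF iFh sub(1)] integrable_on_subinterval[OF ia sub(1)]
    have comb: "integral {a..t} g = integral {a..s} g + integral {s..t} g" if "g integrable_on {a..b}" for g :: "real \<Rightarrow> real"
      using Henstock_Kurzweil_Integration.integral_combine[of a s t g] integrable_on_subinterval[OF that sub(2)] st by simp
    have Fst: "F t - F s = integral {s..t} f" using comb[OF if_] by (simp add: F_def)
    have ch'st: "continuous_on {s..t} h'" "continuous_on {s..t} F"
      using h' cF sub continuous_on_subset by blast+
    have "(h' has_integral (h t - h s)) {s..t}"
      using st sub by (intro fundamental_theorem_of_calculus)
        (auto simp: has_real_derivative_iff_has_vector_derivative[symmetric] intro!: DERIV_subset[OF h sub(1)])
    then have hst: "h t - h s = integral {s..t} h'" by (simp add: integral_unique)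
    have e1: "integral {s..t} (\<lambda>r. f r * (h t - h r)) = (F t - F s) * h t - integral {s..t} (\<lambda>r. f r * h r)"
    proof -
      have "integral {s..t} (\<lambda>r. f r * (h t - h r)) = integral {s..t} (\<lambda>r. f r * h t - f r * h r)"
        by (simp add: algebra_simps)
      also have "\<dots> = integral {s..t} (\<lambda>r. f r * h t) - integral {s..t} (\<lambda>r. f r * h r)"
        using int by (intro Henstock_Kurzweil_Integration.integral_diff integrable_on_mult_left) auto
      finally show ?thesis by (simp add: Fst)
    qed
    have e2: "integral {s..t} (\<lambda>r. (F r - F s) * h' r) = integral {s..t} (\<lambda>r. F r * h' r) - F s * (h t - h s)"
    proof -
      have "integral {s..t} (\<lambda>r. (F r - F s) * h' r) = integral {s..t} (\<lambda>r. F r * h' r - F s * h' r)"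
        by (simp add: algebra_simps)
      also have "\<dots> = integral {s..t} (\<lambda>r. F r * h' r) - integral {s..t} (\<lambda>r. F s * h' r)"
        using int ch'st by (intro Henstock_Kurzweil_Integration.integral_diff integrable_on_mult_right integrable_continuous_real[OF ch'st(1)])
      finally show ?thesis by (simp add: hst)
    qed
    \<comment> \<open>Arranged so that each integrand carries an increment: that of \<open>h\<close>
      is at most \<open>M (t - s)\<close>, that of \<open>F\<close> at most
      \<open>N t - N s\<close>. Both integrals are therefore of smaller order than
      \<open>t - s\<close>.\<close>
    have eq: "P t - P s = integral {s..t} (\<lambda>r. f r * (h t - h r)) - integral {s..t} (\<lambda>r. (F r - F s) * h' r)"
      unfolding e1 e2 P_def using comb[OF ifh] comb[OF iFh] by (simp add: algebra_simps)
    have Nst: "integral {s..t} (\<lambda>r. \<bar>f r\<bar>) = N t - N s" using comb[OF ia] by (simp add: N_def)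
    have b1: "norm (integral {s..t} (\<lambda>r. f r * (h t - h r))) \<le> integral {s..t} (\<lambda>r. \<bar>f r\<bar> * (M * (t - s)))"
    proof (rule integral_norm_bound_integral)
      have "(\<lambda>r. f r * (h t - h r)) = (\<lambda>r. f r * h t - f r * h r)" by (auto simp: algebra_simps)
      then show "(\<lambda>r. f r * (h t - h r)) integrable_on {s..t}"
        using int by (auto intro!: integrable_diff integrable_on_mult_left)
      show "(\<lambda>r. \<bar>f r\<bar> * (M * (t - s))) integrable_on {s..t}" using int by (intro integrable_on_mult_left)
      fix r assume r: "r \<in> {s..t}"
      have "\<bar>h t - h r\<bar> \<le> M * \<bar>t - r\<bar>" using hl[of r t] r st by simp
      also have "\<dots> \<le> M * (t - s)" using r M by (intro mult_left_mono) auto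
      finally show "norm (f r * (h t - h r)) \<le> \<bar>f r\<bar> * (M * (t - s))"
        by (simp add: abs_mult mult_left_mono)
    qed
    have b2: "norm (integral {s..t} (\<lambda>r. (F r - F s) * h' r)) \<le> integral {s..t} (\<lambda>r. (N t - N s) * M)"
    proof (rule integral_norm_bound_integral)
      show "(\<lambda>r. (F r - F s) * h' r) integrable_on {s..t}"
        using ch'st by (intro integrable_continuous_real continuous_intros)
      fix r assume r: "r \<in> {s..t}"
      have sr: "{s..r} \<subseteq> {a..b}" "{a..r} \<subseteq> {a..b}" "{s..r} \<subseteq> {s..t}" using r st by auto
      have "F r - F s = integral {s..r} f"
        using Henstock_Kurzweil_Integration.integral_combine[of a s r f] integrable_on_subinterval[OF if_ sr(2)] st r
        by (simp add: F_def)
      also have "norm \<dots> \<le> integral {s..r} (\<lambda>r. \<bar>f r\<bar>)"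
        by (rule integral_norm_bound_integral[OF integrable_on_subinterval[OF if_ sr(1)] integrable_on_subinterval[OF ia sr(1)]]) auto
      also have "\<dots> \<le> N t - N s"
        unfolding Nst[symmetric] using sr int integrable_on_subinterval[OF ia sr(1)]
        by (intro integral_subset_le) auto
      finally show "norm ((F r - F s) * h' r) \<le> (N t - N s) * M"
        using M(1)[of r] r sub by (auto simp: abs_mult intro!: mult_mono)
    qed auto
    have "0 \<le> N t - N s" unfolding Nst[symmetric] by (rule Henstock_Kurzweil_Integration.integral_nonneg[OF int(4)]) auto
    moreover have "integral {s..t} (\<lambda>r. \<bar>f r\<bar> * (M * (t - s))) = (N t - N s) * (M * (t - s))"
      using Nst by simp
    moreover have "integral {s..t} (\<lambda>r. (N t - N s) * M) = (t - s) * ((N t - N s) * M)" using st by simp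
    ultimately have "\<bar>P t - P s\<bar> \<le> (t - s) * (2 * M * N t - 2 * M * N s)"
      using b1 b2 unfolding eq by (simp add: algebra_simps)
    also have "\<dots> \<le> (t - s) * \<bar>2 * M * N t - 2 * M * N s\<bar>" using st by (intro mult_left_mono) auto
    finally show ?thesis .
  qed
  have "(P has_real_derivative 0) (at x within {a..b})" if x: "x \<in> {a..b}" for x
  proof (rule has_real_derivative_0_if_abs_diff_le[where G = "\<lambda>t. 2 * M * N t", OF _ x])
    show "continuous_on {a..b} (\<lambda>t. 2 * M * N t)" by (intro continuous_intros cN)
    fix y assume "y \<in> {a..b}"
    with x key[of x y] key[of y x] show "\<bar>P y - P x\<bar> \<le> \<bar>y - x\<bar> * \<bar>2 * M * N y - 2 * M * N x\<bar>"
      by (cases "x \<le> y") (auto simp: abs_minus_commute)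
  qed
  then have "\<exists>c. \<forall>x\<in>{a..b}. P x = c"
    by (intro has_field_derivative_zero_constant) auto
  then have "P a = P b" using ab by auto
  moreover have "P a = 0" by (simp add: P_def F_def)
  ultimately show ?thesis by (simp add: P_def F_def)
qed

text \<open>Split \<open>\<bar>V\<bar> \<le> n + max 0 (\<bar>V\<bar> - n)\<close>: the excess over
  a large level \<open>n\<close> has integral below 1/4, and the bounded part contributes at most
  \<open>n / K\<close> times the exponential. The factor 1/2 makes the Volterra operator a
  contraction in the norm weighted by \<open>exp (- K t)\<close>, on the whole interval at
  once.\<close>

lemma exponential_weight_integral_le_half:
  fixes V :: "real \<Rightarrow> real"
  assumes V: "V absolutely_integrable_on {0..1}"
  shows "\<exists>K>0. \<forall>t\<in>{0..1}. integral {0..t} (\<lambda>s. \<bar>V s\<bar> * exp (K * s)) \<le> exp (K * t) / 2"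
proof -
  have ia: "(\<lambda>s. \<bar>V s\<bar>) absolutely_integrable_on {0..1}"
    by (rule set_integrable_abs[OF V])
  then have ia': "(\<lambda>s. \<bar>V s\<bar>) integrable_on {0..1}"
    by (simp add: absolutely_integrable_on_def)
  define g where "g = (\<lambda>(n::nat) s. max 0 (\<bar>V s\<bar> - real n))"
  have "(\<lambda>n. integral {0..1} (g n)) \<longlonglongrightarrow> integral {0..1} (\<lambda>s::real. 0::real)"
  proof (rule dominated_convergence(2)[OF _ ia'])
    show "g n integrable_on {0..1}" for n
    proof -
      have "(\<lambda>s. \<bar>V s\<bar> - real n) absolutely_integrable_on {0..1}"
        by (intro set_integral_diff ia absolutely_integrable_continuous_real continuous_intros)
      then have "(\<lambda>s. max 0 (\<bar>V s\<bar> - real n)) absolutely_integrable_on {0..1}"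
        by (intro absolutely_integrable_max_1) (auto intro: absolutely_integrable_continuous_real)
      then show ?thesis by (simp add: absolutely_integrable_on_def g_def)
    qed
    show "norm (g n x) \<le> \<bar>V x\<bar>" for n x by (auto simp: g_def)
    show "(\<lambda>n. g n x) \<longlonglongrightarrow> 0" for x
    proof (rule tendsto_eventually)
      have "\<forall>\<^sub>F n in sequentially. real n \<ge> \<bar>V x\<bar>"
        by (rule eventually_sequentiallyI[of "nat \<lceil>\<bar>V x\<bar>\<rceil>"]) linarith
      then show "\<forall>\<^sub>F n in sequentially. g n x = 0"
        by eventually_elim (auto simp: g_def)
    qed
  qed
  then have "\<forall>\<^sub>F n in sequentially. integral {0..1} (g n) < 1/4"
    by (intro order_tendstoD) auto
  then obtain n where n: "integral {0..1} (g n) < 1/4" by (auto simp: eventually_sequentially)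
  have ig: "g n absolutely_integrable_on {0..1}"
    unfolding g_def by (intro absolutely_integrable_max_1 set_integral_diff ia absolutely_integrable_continuous_real continuous_on_const)
  \<comment> \<open>This gives \<open>n / K \<le> 1/4\<close>; the added 1 keeps \<open>K\<close>
    positive when \<open>n = 0\<close>.\<close>
  define K where "K = 4 * real n + 1"
  have K: "K > 0" by (simp add: K_def)
  show ?thesis
  proof (intro exI[of _ K] conjI ballI K)
    fix t :: real assume t: "t \<in> {0..1}"
    then have sub: "{0..t} \<subseteq> {0..1}" by auto
    note int_sub = integrable_on_subinterval[OF _ sub]
    have iexp: "((\<lambda>s. exp (K * s)) has_integral (exp (K * t) / K - exp (K * 0) / K)) {0..t}"
      using t K by (intro fundamental_theorem_of_calculus)
        (auto simp: has_real_derivative_iff_has_vector_derivative[symmetric] intro!: derivative_eq_intros)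
    have i1: "(\<lambda>s. \<bar>V s\<bar> * exp (K * s)) integrable_on {0..t}"
      using absolutely_integrable_mult_continuous[OF ia, of "\<lambda>s. exp (K * s)"]
      by (intro int_sub) (simp add: absolutely_integrable_on_def continuous_intros)
    have i2: "(\<lambda>s. real n * exp (K * s)) integrable_on {0..t}"
      using iexp by (intro integrable_on_mult_right) auto
    have i3: "g n integrable_on {0..t}" using ig by (intro int_sub) (simp add: absolutely_integrable_on_def)
    then have i4: "(\<lambda>s. g n s * exp (K * t)) integrable_on {0..t}" by (rule integrable_on_mult_left)
    have "integral {0..t} (\<lambda>s. \<bar>V s\<bar> * exp (K * s)) \<le> integral {0..t} (\<lambda>s. real n * exp (K * s) + g n s * exp (K * t))"
    proof (rule integral_le[OF i1 integrable_add[OF i2 i4]])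
      fix s assume s: "s \<in> {0..t}"
      have "\<bar>V s\<bar> * exp (K * s) \<le> (real n + g n s) * exp (K * s)"
        by (intro mult_right_mono) (auto simp: g_def)
      also have "\<dots> \<le> real n * exp (K * s) + g n s * exp (K * t)"
        using s K by (auto simp: distrib_right g_def intro!: mult_left_mono)
      finally show "\<bar>V s\<bar> * exp (K * s) \<le> real n * exp (K * s) + g n s * exp (K * t)" .
    qed
    also have "\<dots> = real n * ((exp (K * t) - 1) / K) + integral {0..t} (g n) * exp (K * t)"
      using i2 i4 integral_unique[OF iexp] by (simp add: Henstock_Kurzweil_Integration.integral_add diff_divide_distrib)
    also have "\<dots> \<le> exp (K * t) / 4 + 1 / 4 * exp (K * t)"
    proof (intro add_mono mult_right_mono)
      have "real n * (exp (K * t) - 1) \<le> real n * exp (K * t)" by (intro mult_left_mono) auto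
      also have "\<dots> \<le> K / 4 * exp (K * t)" by (intro mult_right_mono) (auto simp: K_def)
      finally show "real n * ((exp (K * t) - 1) / K) \<le> exp (K * t) / 4"
        using K by (simp add: field_simps)
      have "integral {0..t} (g n) \<le> integral {0..1} (g n)"
        using sub i3 ig by (intro integral_subset_le) (auto simp: g_def absolutely_integrable_on_def)
      then show "integral {0..t} (g n) \<le> 1 / 4" using n by simp
    qed auto
    finally show "integral {0..t} (\<lambda>s. \<bar>V s\<bar> * exp (K * s)) \<le> exp (K * t) / 2" by simp
  qed
qed

text \<open>At a maximum point \<open>x\<close> of \<open>exp (- K t) * f t\<close> the hypothesis
  and the weighted estimate give \<open>f x \<le> f x / 2\<close>.\<close>

lemma homogeneous_gronwall:
  fixes V f :: "real \<Rightarrow> real"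
  assumes V: "V absolutely_integrable_on {0..1}" and f: "continuous_on {0..1} f"
    and f0: "\<And>t. t \<in> {0..1} \<Longrightarrow> f t \<ge> 0"
    and le: "\<And>t. t \<in> {0..1} \<Longrightarrow> f t \<le> integral {0..t} (\<lambda>s. \<bar>V s\<bar> * f s)"
    and t: "t \<in> {0..1}"
  shows "f t = 0"
proof -
  obtain K where K: "K > 0"
    "\<And>t. t \<in> {0..1} \<Longrightarrow> integral {0..t} (\<lambda>s. \<bar>V s\<bar> * exp (K * s)) \<le> exp (K * t) / 2"
    using exponential_weight_integral_le_half[OF V] by blast
  have ia: "(\<lambda>s. \<bar>V s\<bar>) absolutely_integrable_on {0..1}"
    by (rule set_integrable_abs[OF V])
  define w where "w = (\<lambda>t. exp (- (K * t)) * f t)"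
  have "continuous_on {0..1} w" unfolding w_def by (intro continuous_intros f)
  then obtain x where x: "x \<in> {0..1}" "\<And>s. s \<in> {0..1} \<Longrightarrow> w s \<le> w x"
    using continuous_attains_sup[of "{0..1}" w] by auto
  have fs: "f s \<le> w x * exp (K * s)" if "s \<in> {0..1}" for s
    using x(2)[OF that] by (simp add: w_def exp_minus field_simps)
  have sub: "{0..x} \<subseteq> {0..1}" using x by auto
  have int: "(\<lambda>s. \<bar>V s\<bar> * h s) integrable_on {0..x}" if "continuous_on {0..1} h" for h
    using absolutely_integrable_mult_continuous[OF ia that]
    by (intro integrable_on_subinterval[OF _ sub]) (simp add: absolutely_integrable_on_def)
  have "f x \<le> integral {0..x} (\<lambda>s. \<bar>V s\<bar> * f s)" by (rule le[OF x(1)])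
  also have "\<dots> \<le> integral {0..x} (\<lambda>s. \<bar>V s\<bar> * (w x * exp (K * s)))"
    using fs sub f by (intro integral_le int mult_left_mono continuous_intros) auto
  also have "\<dots> = w x * integral {0..x} (\<lambda>s. \<bar>V s\<bar> * exp (K * s))"
    by (simp add: mult.left_commute)
  also have "\<dots> \<le> w x * (exp (K * x) / 2)"
    using f0[OF x(1)] by (intro mult_left_mono K x) (simp add: w_def)
  also have "\<dots> = f x / 2" by (simp add: w_def exp_minus)
  finally have "f x \<le> 0" by simp
  then have "w x \<le> 0" by (simp add: w_def mult_le_0_iff)
  then have "w t \<le> 0" using x(2)[OF t] by simp
  then show ?thesis using f0[OF t] by (simp add: w_def mult_le_0_iff)
qed

section \<open>The initial value problem\<close>

lemma absolutely_integrable_on_if_set_integrable_lborel: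
  fixes V :: "real \<Rightarrow> real"
  assumes "set_integrable lborel S V"
  shows "V absolutely_integrable_on S"
  using assms borel_measurable_integrable[of lborel "\<lambda>x. indicator S x *\<^sub>R V x"]
  unfolding set_integrable_def by (subst integrable_completion) auto

lemma set_integrable_mult_continuous_on:
  fixes V h :: "real \<Rightarrow> real"
  assumes V: "set_integrable lborel {a..b} V" and h: "continuous_on {a..b} h"
  shows "set_integrable lborel {a..b} (\<lambda>s. V s * h s)"
proof -
  obtain M where M: "\<And>s. s \<in> {a..b} \<Longrightarrow> \<bar>h s\<bar> \<le> M"
    using compact_imp_bounded[OF compact_continuous_image[OF h]] unfolding bounded_iff real_norm_def by blast
  have mh: "(\<lambda>s. indicator {a..b} s *\<^sub>R h s) \<in> borel_measurable lborel"
    using borel_measurable_continuous_on_indicator[OF _ h] by simp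
  have mV: "(\<lambda>s. indicator {a..b} s *\<^sub>R V s) \<in> borel_measurable lborel"
    using V unfolding set_integrable_def by (rule borel_measurable_integrable)
  have eq: "indicator {a..b} s *\<^sub>R (V s * h s) = (indicator {a..b} s *\<^sub>R V s) * (indicator {a..b} s *\<^sub>R h s)" for s
    by (simp add: indicator_def)
  show ?thesis
    unfolding set_integrable_def
  proof (rule Bochner_Integration.integrable_bound)
    show "integrable lborel (\<lambda>s. M *\<^sub>R (indicator {a..b} s *\<^sub>R V s))"
      using V unfolding set_integrable_def by (rule integrable_scaleR_right)
    show "(\<lambda>s. indicator {a..b} s *\<^sub>R (V s * h s)) \<in> borel_measurable lborel"
      unfolding eq by (rule borel_measurable_times[OF mV mh])
    show "AE s in lborel. norm (indicator {a..b} s *\<^sub>R (V s * h s)) \<le> norm (M *\<^sub>R (indicator {a..b} s *\<^sub>R V s))"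
    proof (intro AE_I2)
      fix s show "norm (indicator {a..b} s *\<^sub>R (V s * h s)) \<le> norm (M *\<^sub>R (indicator {a..b} s *\<^sub>R V s))"
      proof (cases "s \<in> {a..b}")
        case True
        have "\<bar>h s\<bar> \<le> \<bar>M\<bar>" using M[OF True] by simp
        then show ?thesis using True by (simp add: abs_mult mult.commute[of "\<bar>M\<bar>"] mult_left_mono)
      qed simp
    qed
  qed
qed

text \<open>Moves from the Borel integral of the definition to the Henstock-Kurzweil integral, with
  \<open>V\<close> split off as the only factor that may be discontinuous.\<close>

lemma y_sol_iff_integral:
  assumes V: "set_integrable lborel {0..1} V"
  shows "y_sol V y \<longleftrightarrow> continuous_on {0..1} y \<and>
     (\<forall>t\<in>{0..1}. y t = t + integral {0..t} (\<lambda>s. V s * ((t - s) * y s)))"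
proof -
  have "(LINT s:{0..t}|lborel. (t - s) * V s * y s) = integral {0..t} (\<lambda>s. V s * ((t - s) * y s))"
    if y: "continuous_on {0..1} y" and t: "t \<in> {0..1}" for t
  proof -
    have sub: "{0..t} \<subseteq> {0..1}" using t by auto
    have "set_integrable lborel {0..t} (\<lambda>s. V s * ((t - s) * y s))"
      by (intro set_integrable_mult_continuous_on set_integrable_subset[OF V] continuous_intros
            continuous_on_subset[OF y sub]) (use sub in auto)
    then have "(LINT s:{0..t}|lborel. V s * ((t - s) * y s)) = integral {0..t} (\<lambda>s. V s * ((t - s) * y s))"
      by (rule set_borel_integral_eq_integral)
    then show ?thesis by (simp add: ac_simps)
  qed
  then show ?thesis unfolding y_sol_def by auto
qed

text \<open>Banach's fixed point theorem for \<open>u t = exp (- K t) * y t\<close>: the plain sup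
  norm of \<open>u\<close> is the weighted norm of \<open>y\<close>, in which the Volterra operator
  has Lipschitz constant 1/2.\<close>

lemma y_sol_exists:
  assumes V: "set_integrable lborel {0..1} V"
  shows "\<exists>y. y_sol V y"
proof -
  have aV: "V absolutely_integrable_on {0..1}"
    by (rule absolutely_integrable_on_if_set_integrable_lborel[OF V])
  have ia: "(\<lambda>s. \<bar>V s\<bar>) absolutely_integrable_on {0..1}"
    by (rule set_integrable_abs[OF aV])
  obtain K where K: "K > 0"
    "\<And>t. t \<in> {0..1} \<Longrightarrow> integral {0..t} (\<lambda>s. \<bar>V s\<bar> * exp (K * s)) \<le> exp (K * t) / 2"
    using exponential_weight_integral_le_half[OF aV] by blast
  \<comment> \<open>Clamping extends functions from [0,1] to the whole line, so that the complete
    space of bounded continuous functions on \<open>real\<close> can be used.\<close>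
  define cl where "cl = (\<lambda>t::real. max 0 (min 1 t))"
  have cl: "cl t \<in> {0..1}" for t by (auto simp: cl_def)
  have cl_id: "t \<in> {0..1} \<Longrightarrow> cl t = t" for t by (auto simp: cl_def)
  have ccl: "continuous_on UNIV cl" unfolding cl_def by (intro continuous_intros)
  define I where "I = (\<lambda>h t. integral {0..t} (\<lambda>s. V s * h s))"
  have int: "(\<lambda>s. V s * h s) integrable_on {0..t}" "(\<lambda>s. \<bar>V s\<bar> * h s) integrable_on {0..t}"
    if "continuous_on {0..1} h" "t \<in> {0..1}" for h t
  proof -
    have sub: "{0..t} \<subseteq> {0..1}" using that by auto
    show "(\<lambda>s. V s * h s) integrable_on {0..t}" "(\<lambda>s. \<bar>V s\<bar> * h s) integrable_on {0..t}"
      using absolutely_integrable_mult_continuous[OF aV that(1)] absolutely_integrable_mult_continuous[OF ia that(1)]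
      by (auto intro!: integrable_on_subinterval[OF _ sub] simp: absolutely_integrable_on_def)
  qed
  have cI: "continuous_on {0..1} (I h)" if "continuous_on {0..1} h" for h
    unfolding I_def by (rule indefinite_integral_continuous_1[OF int(1)[OF that]]) auto
  \<comment> \<open>The kernel \<open>t - s\<close> is split so that \<open>t\<close> leaves the
    integrals; continuity of \<open>P u\<close> then follows from that of indefinite
    integrals.\<close>
  define P where "P = (\<lambda>u t. exp (- (K * t)) * (t + (t * I (\<lambda>s. exp (K * s) * u s) t - I (\<lambda>s. s * (exp (K * s) * u s)) t)))"
  have P_eq: "P u t = exp (- (K * t)) * (t + integral {0..t} (\<lambda>s. V s * ((t - s) * (exp (K * s) * u s))))"
    if "continuous_on {0..1} u" "t \<in> {0..1}" for u t
  proof -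
    have "integral {0..t} (\<lambda>s. V s * ((t - s) * (exp (K * s) * u s)))
        = integral {0..t} (\<lambda>s. t * (V s * (exp (K * s) * u s)) - V s * (s * (exp (K * s) * u s)))"
      by (intro arg_cong[where f = "integral _"]) (auto simp: algebra_simps)
    also have "\<dots> = integral {0..t} (\<lambda>s. t * (V s * (exp (K * s) * u s))) - integral {0..t} (\<lambda>s. V s * (s * (exp (K * s) * u s)))"
      using that by (intro Henstock_Kurzweil_Integration.integral_diff int integrable_on_mult_right continuous_intros) auto
    finally show ?thesis unfolding P_def I_def by simp
  qed
  have cP: "continuous_on {0..1} (P u)" if "continuous_on {0..1} u" for u
    unfolding P_def by (intro continuous_intros cI that)
  have in_b: "(\<lambda>t. P (apply_bcontfun u) (cl t)) \<in> bcontfun" for u :: "real \<Rightarrow>\<^sub>C real"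
  proof -
    have c: "continuous_on {0..1} (P (apply_bcontfun u))" by (intro cP continuous_on_apply_bcontfun)
    have "continuous_on UNIV (\<lambda>t. P (apply_bcontfun u) (cl t))"
      using cl by (intro continuous_on_compose2[OF c ccl]) auto
    moreover obtain M where "\<And>t. t \<in> {0..1} \<Longrightarrow> \<bar>P (apply_bcontfun u) t\<bar> \<le> M"
      using compact_imp_bounded[OF compact_continuous_image[OF c]] unfolding bounded_iff real_norm_def by blast
    ultimately show ?thesis using cl by (intro bcontfun_normI[where b = M]) auto
  qed
  define T where "T = (\<lambda>u :: real \<Rightarrow>\<^sub>C real. Bcontfun (\<lambda>t. P (apply_bcontfun u) (cl t)))"
  have T: "apply_bcontfun (T u) t = P (apply_bcontfun u) (cl t)" for u t
    unfolding T_def by (simp add: Bcontfun_inverse[OF in_b])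
  have contr: "dist (T u) (T w) \<le> 1/2 * dist u w" for u w
  proof (rule dist_bound)
    fix t0
    define t where "t = cl t0"
    have t: "t \<in> {0..1}" using cl by (simp add: t_def)
    have c: "continuous_on S (apply_bcontfun u)" "continuous_on S (apply_bcontfun w)" for S by auto
    have "P (apply_bcontfun u) t - P (apply_bcontfun w) t
       = exp (- (K * t)) * (integral {0..t} (\<lambda>s. V s * ((t - s) * (exp (K * s) * apply_bcontfun u s)))
          - integral {0..t} (\<lambda>s. V s * ((t - s) * (exp (K * s) * apply_bcontfun w s))))"
      using c t by (simp add: P_eq algebra_simps)
    also have "\<dots> = exp (- (K * t)) * integral {0..t} (\<lambda>s. V s * ((t - s) * (exp (K * s) * apply_bcontfun u s))
          - V s * ((t - s) * (exp (K * s) * apply_bcontfun w s)))"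
      using c t by (subst Henstock_Kurzweil_Integration.integral_diff) (auto intro!: int continuous_intros)
    finally have "\<bar>P (apply_bcontfun u) t - P (apply_bcontfun w) t\<bar>
        \<le> exp (- (K * t)) * integral {0..t} (\<lambda>s. \<bar>V s\<bar> * (exp (K * s) * dist u w))"
    proof (elim ssubst)
      have "norm (integral {0..t} (\<lambda>s. V s * ((t - s) * (exp (K * s) * apply_bcontfun u s))
          - V s * ((t - s) * (exp (K * s) * apply_bcontfun w s))))
          \<le> integral {0..t} (\<lambda>s. \<bar>V s\<bar> * (exp (K * s) * dist u w))"
      proof (rule integral_norm_bound_integral)
        show "(\<lambda>s. V s * ((t - s) * (exp (K * s) * apply_bcontfun u s))
            - V s * ((t - s) * (exp (K * s) * apply_bcontfun w s))) integrable_on {0..t}"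
          using c t by (auto intro!: integrable_diff int continuous_intros)
        show "(\<lambda>s. \<bar>V s\<bar> * (exp (K * s) * dist u w)) integrable_on {0..t}"
          using t by (intro int continuous_intros)
        fix s assume s: "s \<in> {0..t}"
        have "V s * ((t - s) * (exp (K * s) * apply_bcontfun u s)) - V s * ((t - s) * (exp (K * s) * apply_bcontfun w s))
          = V s * ((t - s) * (exp (K * s) * (apply_bcontfun u s - apply_bcontfun w s)))"
          by (simp add: algebra_simps)
        also have "norm \<dots> = \<bar>V s\<bar> * ((t - s) * (exp (K * s) * \<bar>apply_bcontfun u s - apply_bcontfun w s\<bar>))"
          using s by (simp add: abs_mult)
        also have "\<dots> \<le> \<bar>V s\<bar> * (1 * (exp (K * s) * dist u w))"
          using s t dist_bounded[of u s w] by (intro mult_left_mono mult_mono) (auto simp: dist_real_def)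
        finally show "norm (V s * ((t - s) * (exp (K * s) * apply_bcontfun u s)) - V s * ((t - s) * (exp (K * s) * apply_bcontfun w s)))
            \<le> \<bar>V s\<bar> * (exp (K * s) * dist u w)" by simp
      qed
      then show "\<bar>exp (- (K * t)) * integral {0..t} (\<lambda>s. V s * ((t - s) * (exp (K * s) * apply_bcontfun u s))
          - V s * ((t - s) * (exp (K * s) * apply_bcontfun w s)))\<bar>
          \<le> exp (- (K * t)) * integral {0..t} (\<lambda>s. \<bar>V s\<bar> * (exp (K * s) * dist u w))"
        by (simp add: abs_mult)
    qed
    also have "\<dots> = exp (- (K * t)) * (integral {0..t} (\<lambda>s. \<bar>V s\<bar> * exp (K * s)) * dist u w)"
      using Henstock_Kurzweil_Integration.integral_mult_left[of "{0..t}" "\<lambda>s. \<bar>V s\<bar> * exp (K * s)" "dist u w"]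
      by (simp only: mult.assoc)
    also have "\<dots> \<le> exp (- (K * t)) * (exp (K * t) / 2 * dist u w)"
      using K(2)[OF t] by (intro mult_left_mono mult_right_mono) auto
    also have "\<dots> = 1/2 * dist u w" by (simp add: exp_minus)
    finally show "dist (apply_bcontfun (T u) t0) (apply_bcontfun (T w) t0) \<le> 1/2 * dist u w"
      by (simp add: T t_def dist_real_def)
  qed
  obtain u where u: "T u = u"
    using banach_fix_type[of "1/2" T] contr by auto
  define y where "y = (\<lambda>t. exp (K * t) * apply_bcontfun u t)"
  have cy: "continuous_on {0..1} y" unfolding y_def by (intro continuous_intros continuous_on_apply_bcontfun)
  moreover have "y t = t + integral {0..t} (\<lambda>s. V s * ((t - s) * y s))" if t: "t \<in> {0..1}" for t
  proof -
    have "apply_bcontfun u t = P (apply_bcontfun u) t"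
      using T[of u t] u cl_id[OF t] by simp
    also have "\<dots> = exp (- (K * t)) * (t + integral {0..t} (\<lambda>s. V s * ((t - s) * y s)))"
      using t by (subst P_eq) (auto simp: y_def)
    finally show ?thesis by (simp add: y_def exp_minus)
  qed
  ultimately show ?thesis unfolding y_sol_iff_integral[OF V] by blast
qed

section \<open>Comparison, uniqueness and differentiability of solutions\<close>

lemma y_sol_integrand_integrable:
  fixes V y :: "real \<Rightarrow> real"
  assumes V: "set_integrable lborel {0..1} V" and y: "continuous_on {0..1} y" and t: "t \<in> {0..1}"
  shows "(\<lambda>s. V s * ((t - s) * y s)) integrable_on {0..t}"
proof -
  have sub: "{0..t} \<subseteq> {0..1}" using t by auto
  have "(\<lambda>s. V s * ((t - s) * y s)) absolutely_integrable_on {0..1}"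
    by (intro absolutely_integrable_mult_continuous continuous_intros y
        absolutely_integrable_on_if_set_integrable_lborel[OF V])
  then show ?thesis
    by (intro integrable_on_subinterval[OF _ sub]) (simp add: absolutely_integrable_on_def)
qed

text \<open>The negative part of the difference satisfies a homogeneous Gronwall inequality.\<close>
lemma y_sol_abs_le:
  assumes V: "set_integrable lborel {0..1} V" and W: "set_integrable lborel {0..1} W"
    and VW: "\<And>s. s \<in> {0..1} \<Longrightarrow> \<bar>V s\<bar> \<le> W s"
    and y: "y_sol V y" and z: "y_sol W z" and t: "t \<in> {0..1}"
  shows "\<bar>y t\<bar> \<le> z t"
proof -
  have cy: "continuous_on {0..1} y" and cz: "continuous_on {0..1} z"
    using y z by (auto simp: y_sol_def)
  have ey: "y t = t + integral {0..t} (\<lambda>s. V s * ((t - s) * y s))"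
    and ez: "z t = t + integral {0..t} (\<lambda>s. W s * ((t - s) * z s))" if "t \<in> {0..1}" for t
    using y z that unfolding y_sol_iff_integral[OF V] y_sol_iff_integral[OF W] by auto
  define f where "f = (\<lambda>t. max 0 (\<bar>y t\<bar> - z t))"
  have cf: "continuous_on {0..1} f" unfolding f_def by (intro continuous_intros cy cz)
  note aW = absolutely_integrable_on_if_set_integrable_lborel[OF W]
  have "f t \<le> integral {0..t} (\<lambda>s. \<bar>W s\<bar> * f s)" if t: "t \<in> {0..1}" for t
  proof -
    have sub: "{0..t} \<subseteq> {0..1}" using t by auto
    have W0: "0 \<le> W s" if "s \<in> {0..1}" for s using VW[OF that] by simp
    have i4: "(\<lambda>s. \<bar>W s\<bar> * f s) integrable_on {0..t}"
      using absolutely_integrable_mult_continuous[OF set_integrable_abs[OF aW] cf]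
      by (intro integrable_on_subinterval[OF _ sub]) (simp add: absolutely_integrable_on_def)
    have i2: "(\<lambda>s. W s * ((t - s) * \<bar>y s\<bar>)) integrable_on {0..t}"
      by (intro y_sol_integrand_integrable[OF W _ t] continuous_intros cy)
    have "norm (integral {0..t} (\<lambda>s. V s * ((t - s) * y s))) \<le> integral {0..t} (\<lambda>s. W s * ((t - s) * \<bar>y s\<bar>))"
    proof (rule integral_norm_bound_integral[OF y_sol_integrand_integrable[OF V cy t] i2])
      fix s assume s: "s \<in> {0..t}"
      then show "norm (V s * ((t - s) * y s)) \<le> W s * ((t - s) * \<bar>y s\<bar>)"
        using VW[of s] sub by (auto simp: abs_mult intro!: mult_mono)
    qed
    then have "\<bar>y t\<bar> - z t \<le> integral {0..t} (\<lambda>s. W s * ((t - s) * \<bar>y s\<bar>)) - integral {0..t} (\<lambda>s. W s * ((t - s) * z s))"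
      unfolding ey[OF t] ez[OF t] using t by auto
    also have "\<dots> = integral {0..t} (\<lambda>s. W s * ((t - s) * \<bar>y s\<bar>) - W s * ((t - s) * z s))"
      by (rule Henstock_Kurzweil_Integration.integral_diff[OF i2 y_sol_integrand_integrable[OF W cz t], symmetric])
    also have "\<dots> \<le> integral {0..t} (\<lambda>s. \<bar>W s\<bar> * f s)"
    proof (rule integral_le[OF integrable_diff[OF i2 y_sol_integrand_integrable[OF W cz t]] i4])
      fix s assume s: "s \<in> {0..t}"
      have "W s * ((t - s) * \<bar>y s\<bar>) - W s * ((t - s) * z s) = W s * ((t - s) * (\<bar>y s\<bar> - z s))"
        by (simp add: algebra_simps)
      also have "\<dots> \<le> W s * ((t - s) * f s)"
        using s W0 sub by (intro mult_left_mono) (auto simp: f_def)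
      also have "\<dots> \<le> W s * (1 * f s)"
        using s t W0 sub by (intro mult_left_mono mult_right_mono) (auto simp: f_def)
      finally show "W s * ((t - s) * \<bar>y s\<bar>) - W s * ((t - s) * z s) \<le> \<bar>W s\<bar> * f s"
        using s W0[of s] sub by auto
    qed
    finally have "\<bar>y t\<bar> - z t \<le> integral {0..t} (\<lambda>s. \<bar>W s\<bar> * f s)" .
    moreover have "0 \<le> integral {0..t} (\<lambda>s. \<bar>W s\<bar> * f s)"
      by (rule Henstock_Kurzweil_Integration.integral_nonneg[OF i4]) (auto simp: f_def)
    ultimately show ?thesis unfolding f_def by simp
  qed
  from homogeneous_gronwall[OF aW cf _ this t] have "f t = 0" by (auto simp: f_def)
  then show ?thesis by (simp add: f_def)
qed

lemma y_sol_unique: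
  assumes V: "set_integrable lborel {0..1} V" and y: "y_sol V y" and z: "y_sol V z" and t: "t \<in> {0..1}"
  shows "y t = z t"
proof -
  have cy: "continuous_on {0..1} y" and cz: "continuous_on {0..1} z"
    using y z by (auto simp: y_sol_def)
  have ey: "y t = t + integral {0..t} (\<lambda>s. V s * ((t - s) * y s))"
    and ez: "z t = t + integral {0..t} (\<lambda>s. V s * ((t - s) * z s))" if "t \<in> {0..1}" for t
    using y z that unfolding y_sol_iff_integral[OF V] by auto
  define f where "f = (\<lambda>t. \<bar>y t - z t\<bar>)"
  have cf: "continuous_on {0..1} f" unfolding f_def by (intro continuous_intros cy cz)
  note aV = absolutely_integrable_on_if_set_integrable_lborel[OF V]
  have "f t \<le> integral {0..t} (\<lambda>s. \<bar>V s\<bar> * f s)" if t: "t \<in> {0..1}" for t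
  proof -
    have sub: "{0..t} \<subseteq> {0..1}" using t by auto
    have i4: "(\<lambda>s. \<bar>V s\<bar> * f s) integrable_on {0..t}"
      using absolutely_integrable_mult_continuous[OF set_integrable_abs[OF aV] cf]
      by (intro integrable_on_subinterval[OF _ sub]) (simp add: absolutely_integrable_on_def)
    note i = y_sol_integrand_integrable[OF V cy t] y_sol_integrand_integrable[OF V cz t]
    have "y t - z t = integral {0..t} (\<lambda>s. V s * ((t - s) * y s) - V s * ((t - s) * z s))"
      unfolding Henstock_Kurzweil_Integration.integral_diff[OF i] using ey[OF t] ez[OF t] by simp
    also have "norm \<dots> \<le> integral {0..t} (\<lambda>s. \<bar>V s\<bar> * f s)"
    proof (rule integral_norm_bound_integral[OF integrable_diff[OF i] i4])
      fix s assume s: "s \<in> {0..t}"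
      have "V s * ((t - s) * y s) - V s * ((t - s) * z s) = V s * ((t - s) * (y s - z s))"
        by (simp add: algebra_simps)
      also have "norm \<dots> = \<bar>V s\<bar> * ((t - s) * f s)" using s by (simp add: abs_mult f_def)
      also have "\<dots> \<le> \<bar>V s\<bar> * (1 * f s)"
        using s t by (intro mult_left_mono mult_right_mono) (auto simp: f_def)
      finally show "norm (V s * ((t - s) * y s) - V s * ((t - s) * z s)) \<le> \<bar>V s\<bar> * f s" by simp
    qed
    finally show ?thesis by (simp add: f_def)
  qed
  from homogeneous_gronwall[OF aV cf _ this t] have "f t = 0" by (auto simp: f_def)
  then show ?thesis by (simp add: f_def)
qed

lemma det_T_eq:
  assumes V: "set_integrable lborel {0..1} V" and y: "y_sol V y"
  shows "det_T V = 2 * y 1"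
proof -
  have "(THE r. \<exists>y. y_sol V y \<and> y 1 = r) = y 1"
    using y y_sol_unique[OF V] by (intro the_equality) auto
  then show ?thesis by (simp add: det_T_def)
qed

text \<open>Integration by parts turns the integral with kernel \<open>t - s\<close> into the
  primitive of a continuous function, namely of the indefinite integral of \<open>V y\<close>. Hence
  \<open>y\<close> is differentiable at every point, endpoints included, however irregular
  \<open>V\<close> is.\<close>

lemma y_sol_has_real_derivative:
  assumes V: "set_integrable lborel {0..1} V" and y: "y_sol V y" and t: "t \<in> {0..1}"
  shows "(y has_real_derivative 1 + integral {0..t} (\<lambda>s. V s * y s)) (at t within {0..1})"
proof -
  have cy: "continuous_on {0..1} y" using y by (auto simp: y_sol_def)
  have a: "(\<lambda>s. V s * y s) absolutely_integrable_on {0..1}"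
    by (intro absolutely_integrable_mult_continuous absolutely_integrable_on_if_set_integrable_lborel[OF V] cy)
  then have i: "(\<lambda>s. V s * y s) integrable_on {0..1}" by (simp add: absolutely_integrable_on_def)
  define F where "F = (\<lambda>t. integral {0..t} (\<lambda>s. V s * y s))"
  have cF: "continuous_on {0..1} F" unfolding F_def by (rule indefinite_integral_continuous_1[OF i])
  have eq: "y t = t + integral {0..t} F" if t: "t \<in> {0..1}" for t
  proof -
    have sub: "{0..t} \<subseteq> {0..1}" using t by auto
    have "y t = t + integral {0..t} (\<lambda>s. V s * ((t - s) * y s))"
      using y t unfolding y_sol_iff_integral[OF V] by auto
    also have "integral {0..t} (\<lambda>s. V s * ((t - s) * y s)) = integral {0..t} (\<lambda>s. V s * y s * (t - s))"
      by (simp add: ac_simps)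
    also have "\<dots> = integral {0..t} (\<lambda>s. V s * y s) * (t - t) - integral {0..t} (\<lambda>s. integral {0..s} (\<lambda>s. V s * y s) * -1)"
      using t by (intro integral_by_parts_absolutely_integrable)
        (auto intro!: derivative_eq_intros set_integrable_subset[OF a _ sub] continuous_intros)
    finally show ?thesis by (simp add: F_def)
  qed
  have "((\<lambda>t. t + integral {0..t} F) has_real_derivative 1 + F t) (at t within {0..1})"
    by (intro derivative_intros integral_has_real_derivative[OF cF t])
  then have "(y has_real_derivative 1 + F t) (at t within {0..1})"
    by (rule has_field_derivative_transform_within[where d = 1]) (use t eq in auto)
  then show ?thesis by (simp add: F_def)
qed

section \<open>Logarithmic comparison of solutions\<close>

lemma y_sol_0:
  assumes "set_integrable lborel {0..1} V" "y_sol V y"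
  shows "y 0 = 0"
  using assms(2) unfolding y_sol_iff_integral[OF assms(1)] by force

text \<open>Comparing \<open>y\<close> with itself gives \<open>\<bar>y\<bar> \<le> y\<close>, hence
  a nonnegative integrand in the Volterra equation. The bound keeps \<open>y\<close> away from 0 on
  \<open>{e..1}\<close>, where \<open>ln y\<close> and \<open>y'/y\<close> are formed.\<close>

lemma y_sol_ge:
  assumes V: "set_integrable lborel {0..1} V" and V0: "\<And>s. s \<in> {0..1} \<Longrightarrow> V s \<ge> 0"
    and y: "y_sol V y" and t: "t \<in> {0..1}"
  shows "t \<le> y t"
proof -
  have y0: "0 \<le> y s" if "s \<in> {0..1}" for s
    using y_sol_abs_le[OF V V _ y y that] V0 by auto
  have cy: "continuous_on {0..1} y" using y by (auto simp: y_sol_def)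
  have "y t = t + integral {0..t} (\<lambda>s. V s * ((t - s) * y s))"
    using y t unfolding y_sol_iff_integral[OF V] by auto
  moreover have "0 \<le> integral {0..t} (\<lambda>s. V s * ((t - s) * y s))"
    by (rule Henstock_Kurzweil_Integration.integral_nonneg[OF y_sol_integrand_integrable[OF V cy t]])
       (use t V0 y0 in auto)
  ultimately show ?thesis by simp
qed

text \<open>Since \<open>V y\<close> integrates to increments of \<open>dy\<close>, parts applied to
  \<open>V \<Psi> = (V y) (\<Psi> / y)\<close> remove \<open>V\<close> in favour of
  \<open>u = dy / y\<close>: the integrand \<open>dy (\<Psi> / y)'\<close> equals
  \<open>\<Psi>' u - \<Psi> u^2\<close>. The boundary term at 1 drops because
  \<open>\<Psi> 1 = 0\<close>; the one at \<open>e\<close> stays, the cutoff being forced by the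
  zero of \<open>y\<close> at 0.\<close>

lemma y_sol_log_identity:
  fixes \<Psi> \<Psi>' :: "real \<Rightarrow> real"
  assumes V: "set_integrable lborel {0..1} V" and V0: "\<And>s. s \<in> {0..1} \<Longrightarrow> V s \<ge> 0"
    and y: "y_sol V y" and dy: "dy = (\<lambda>t. 1 + integral {0..t} (\<lambda>s. V s * y s))"
    and \<Psi>: "\<And>t. t \<in> {0..1} \<Longrightarrow> (\<Psi> has_real_derivative \<Psi>' t) (at t within {0..1})"
    and \<Psi>': "continuous_on {0..1} \<Psi>'" and \<Psi>1: "\<Psi> 1 = 0" and e: "0 < e" "e < 1"
  shows "v * (ln (y 1) - ln (y e)) - integral {e..1} (\<lambda>t. V t * \<Psi> t)
    = dy e * \<Psi> e / y e + integral {e..1} (\<lambda>t. (v + \<Psi>' t) * (dy t / y t) - \<Psi> t * (dy t / y t)\<^sup>2)"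
proof -
  have sub: "{e..1} \<subseteq> {0..1}" using e by auto
  have cy: "continuous_on {0..1} y" using y by (auto simp: y_sol_def)
  have ypos: "y t > 0" if "t \<in> {e..1}" for t
    using y_sol_ge[OF V V0 y, of t] that e by auto
  have Dy: "(y has_real_derivative dy t) (at t within {e..1})" if "t \<in> {e..1}" for t
    using y_sol_has_real_derivative[OF V y, of t] that sub unfolding dy by (auto intro: DERIV_subset)
  have D\<Psi>: "(\<Psi> has_real_derivative \<Psi>' t) (at t within {e..1})" if "t \<in> {e..1}" for t
    using \<Psi>[of t] that sub by (auto intro: DERIV_subset)
  have a: "(\<lambda>s. V s * y s) absolutely_integrable_on {0..1}"
    by (intro absolutely_integrable_mult_continuous absolutely_integrable_on_if_set_integrable_lborel[OF V] cy)
  then have i: "(\<lambda>s. V s * y s) integrable_on {0..1}" by (simp add: absolutely_integrable_on_def)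
  have "continuous_on {0..1} dy"
    unfolding dy by (intro continuous_intros indefinite_integral_continuous_1[OF i])
  then have cdy: "continuous_on {e..1} dy" using sub continuous_on_subset by blast
  have cy': "continuous_on {e..1} y" using cy sub continuous_on_subset by blast
  have c\<Psi>': "continuous_on {e..1} \<Psi>'" using \<Psi>' sub continuous_on_subset by blast
  have c\<Psi>: "continuous_on {e..1} \<Psi>"
    using D\<Psi> DERIV_continuous unfolding continuous_on_eq_continuous_within by blast
  have ynz: "\<forall>t\<in>{e..1}. y t \<noteq> 0" using ypos by force
  define h where "h = (\<lambda>t. \<Psi> t / y t)"
  define h' where "h' = (\<lambda>t. (\<Psi>' t * y t - \<Psi> t * dy t) / (y t * y t))"
  have Dh: "(h has_real_derivative h' t) (at t within {e..1})" if "t \<in> {e..1}" for t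
    unfolding h_def h'_def using that ynz by (intro DERIV_divide D\<Psi> Dy) auto
  have ch': "continuous_on {e..1} h'"
    unfolding h'_def using ynz by (intro continuous_intros cy' cdy c\<Psi> c\<Psi>') auto
  have idy: "integral {e..t} (\<lambda>s. V s * y s) = dy t - dy e" if "t \<in> {e..1}" for t
  proof -
    have "{0..t} \<subseteq> {0..1}" using that by auto
    then have "(\<lambda>s. V s * y s) integrable_on {0..t}" by (rule integrable_on_subinterval[OF i])
    then show ?thesis
      unfolding dy using Henstock_Kurzweil_Integration.integral_combine[of 0 e t "\<lambda>s. V s * y s"] that e by auto
  qed
  have ih': "(h' has_integral (h 1 - h e)) {e..1}"
    using e Dh by (intro fundamental_theorem_of_calculus)
      (auto simp: has_real_derivative_iff_has_vector_derivative[symmetric])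
  have "integral {e..1} (\<lambda>t. V t * \<Psi> t) = integral {e..1} (\<lambda>t. V t * y t * h t)"
    using ynz by (intro integral_cong) (auto simp: h_def)
  also have "\<dots> = integral {e..1} (\<lambda>t. V t * y t) * h 1 - integral {e..1} (\<lambda>t. integral {e..t} (\<lambda>t. V t * y t) * h' t)"
    using e by (intro integral_by_parts_absolutely_integrable Dh ch' set_integrable_subset[OF a _ sub]) auto
  also have "\<dots> = - integral {e..1} (\<lambda>t. (dy t - dy e) * h' t)"
    using integral_cong[of "{e..1}" "\<lambda>t. integral {e..t} (\<lambda>t. V t * y t) * h' t" "\<lambda>t. (dy t - dy e) * h' t"] idy
    by (simp add: h_def \<Psi>1)
  also have "integral {e..1} (\<lambda>t. (dy t - dy e) * h' t) = integral {e..1} (\<lambda>t. dy t * h' t - dy e * h' t)"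
    by (simp add: algebra_simps)
  also have "\<dots> = integral {e..1} (\<lambda>t. dy t * h' t) - integral {e..1} (\<lambda>t. dy e * h' t)"
    by (intro Henstock_Kurzweil_Integration.integral_diff integrable_continuous_real continuous_intros cdy ch')
  also have "integral {e..1} (\<lambda>t. dy e * h' t) = - dy e * \<Psi> e / y e"
    using ih' by (simp add: integral_unique h_def \<Psi>1)
  finally have 1: "integral {e..1} (\<lambda>t. V t * \<Psi> t) = - integral {e..1} (\<lambda>t. dy t * h' t) - dy e * \<Psi> e / y e" by simp
  have "((\<lambda>t. dy t / y t) has_integral (ln (y 1) - ln (y e))) {e..1}"
    using e Dy ypos by (intro fundamental_theorem_of_calculus)
      (auto simp: has_real_derivative_iff_has_vector_derivative[symmetric] intro!: derivative_eq_intros)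
  then have 2: "ln (y 1) - ln (y e) = integral {e..1} (\<lambda>t. dy t / y t)" by (simp add: integral_unique)
  have "integral {e..1} (\<lambda>t. (v + \<Psi>' t) * (dy t / y t) - \<Psi> t * (dy t / y t)\<^sup>2)
      = integral {e..1} (\<lambda>t. v * (dy t / y t) + dy t * h' t)"
    using ynz by (intro integral_cong) (auto simp: h'_def field_simps power2_eq_square)
  also have "\<dots> = integral {e..1} (\<lambda>t. v * (dy t / y t)) + integral {e..1} (\<lambda>t. dy t * h' t)"
    using ynz by (intro Henstock_Kurzweil_Integration.integral_add integrable_continuous_real continuous_intros cdy ch' cy') auto
  also have "integral {e..1} (\<lambda>t. v * (dy t / y t)) = v * (ln (y 1) - ln (y e))"
    unfolding 2 by (rule integral_mult_right)
  finally show ?thesis using 1 by simp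
qed

lemma tendsto_div_at_right_0:
  fixes f :: "real \<Rightarrow> real"
  assumes "(f has_real_derivative D) (at 0 within {0..1})" "f 0 = 0"
  shows "((\<lambda>t. f t / t) \<longlongrightarrow> D) (at_right 0)"
proof -
  have "((\<lambda>t. f t / t) \<longlongrightarrow> D) (at 0 within {0..1})"
    using assms by (simp add: has_field_derivative_iff)
  then show ?thesis by (simp add: at_within_Icc_at_right)
qed

text \<open>With \<open>u = y'/y\<close> and \<open>w = z'/z\<close>, the hypothesis on \<open>z\<close> reads \<open>\<Psi>' + v = 2 \<Psi> w\<close>, so that the integrands of
  the two logarithmic identities differ by \<open>\<Psi> (u - w)\<^sup>2\<close>.\<close>
lemma log_y_sol_comparison:
  fixes \<Psi> \<Psi>' :: "real \<Rightarrow> real"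
  assumes V: "set_integrable lborel {0..1} V" and V0: "\<And>s. s \<in> {0..1} \<Longrightarrow> V s \<ge> 0" and y: "y_sol V y"
    and U: "set_integrable lborel {0..1} U" and U0: "\<And>s. s \<in> {0..1} \<Longrightarrow> U s \<ge> 0" and z: "y_sol U z"
    and \<Psi>: "\<And>t. t \<in> {0..1} \<Longrightarrow> (\<Psi> has_real_derivative \<Psi>' t) (at t within {0..1})"
    and \<Psi>': "continuous_on {0..1} \<Psi>'" and \<Psi>0: "\<Psi> 0 = 0" and \<Psi>1: "\<Psi> 1 = 0" and v: "v = \<Psi>' 0"
    and \<Psi>nonneg: "\<And>t. t \<in> {0..1} \<Longrightarrow> \<Psi> t \<ge> 0"
    and riccati: "\<And>t. t \<in> {0..1} \<Longrightarrow> 2 * \<Psi> t * (1 + integral {0..t} (\<lambda>s. U s * z s)) = (\<Psi>' t + v) * z t"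
  shows "v * (ln (y 1) - ln (z 1)) \<le> integral {0..1} (\<lambda>t. V t * \<Psi> t) - integral {0..1} (\<lambda>t. U t * \<Psi> t)"
proof -
  define dy where "dy = (\<lambda>t. 1 + integral {0..t} (\<lambda>s. V s * y s))"
  define dz where "dz = (\<lambda>t. 1 + integral {0..t} (\<lambda>s. U s * z s))"
  have cy: "continuous_on {0..1} y" and cz: "continuous_on {0..1} z" using y z by (auto simp: y_sol_def)
  have c\<Psi>: "continuous_on {0..1} \<Psi>"
    using \<Psi> DERIV_continuous unfolding continuous_on_eq_continuous_within by blast
  have int: "(\<lambda>s. W s * h s) integrable_on {0..1}" if "set_integrable lborel {0..1} W" "continuous_on {0..1} h" for W h :: "real \<Rightarrow> real"
    using absolutely_integrable_mult_continuous[OF absolutely_integrable_on_if_set_integrable_lborel[OF that(1)] that(2)]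
    by (simp add: absolutely_integrable_on_def)
  have cdy: "continuous_on {0..1} dy" and cdz: "continuous_on {0..1} dz"
    unfolding dy_def dz_def by (intro continuous_intros indefinite_integral_continuous_1 int V U cy cz)+
  define L where "L = (\<lambda>e. v * (ln (y 1) - ln (z 1)) - (integral {e..1} (\<lambda>t. V t * \<Psi> t) - integral {e..1} (\<lambda>t. U t * \<Psi> t)))"
  \<comment> \<open>Dividing by \<open>e\<close> makes the limit of the boundary terms visible:
    \<open>y e / e\<close> and \<open>z e / e\<close> tend to 1 and \<open>\<Psi> e / e\<close>
    tends to \<open>v\<close>, so \<open>R\<close> tends to 0 although \<open>ln (y e)\<close> and
    \<open>ln (z e)\<close> diverge separately.\<close>
  define R where "R = (\<lambda>e. v * (ln (y e / e) - ln (z e / e)) + (dy e * (\<Psi> e / e) / (y e / e) - dz e * (\<Psi> e / e) / (z e / e)))"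
  have ge: "t \<le> y t" "t \<le> z t" if "t \<in> {0..1}" for t
    using y_sol_ge[OF V V0 y that] y_sol_ge[OF U U0 z that] by auto
  have LR: "L e \<le> R e" if e: "0 < e" "e < 1" for e
  proof -
    have sub: "{e..1} \<subseteq> {0..1}" using e by auto
    note c = continuous_on_subset[OF cy sub] continuous_on_subset[OF cz sub] continuous_on_subset[OF c\<Psi> sub]
      continuous_on_subset[OF \<Psi>' sub] continuous_on_subset[OF cdy sub] continuous_on_subset[OF cdz sub]
    have "y t > 0 \<and> z t > 0" if "t \<in> {e..1}" for t using ge[of t] that e by auto
    then have nz: "\<forall>t\<in>{e..1}. y t \<noteq> 0" "\<forall>t\<in>{e..1}. z t \<noteq> 0" by (simp_all add: less_le)
    have "integral {e..1} (\<lambda>t. (v + \<Psi>' t) * (dy t / y t) - \<Psi> t * (dy t / y t)\<^sup>2)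
        \<le> integral {e..1} (\<lambda>t. (v + \<Psi>' t) * (dz t / z t) - \<Psi> t * (dz t / z t)\<^sup>2)"
    proof (rule integral_le)
      fix t assume t: "t \<in> {e..1}"
      define u w where "u = dy t / y t" and "w = dz t / z t"
      have "v + \<Psi>' t = 2 * \<Psi> t * w"
        using riccati[of t] t sub nz by (auto simp: w_def dz_def field_simps)
      then have "(v + \<Psi>' t) * w - \<Psi> t * w\<^sup>2 - ((v + \<Psi>' t) * u - \<Psi> t * u\<^sup>2) = \<Psi> t * (u - w)\<^sup>2"
        by (simp add: algebra_simps power2_eq_square)
      moreover have "\<Psi> t * (u - w)\<^sup>2 \<ge> 0" using \<Psi>nonneg[of t] t sub by auto
      ultimately show "(v + \<Psi>' t) * (dy t / y t) - \<Psi> t * (dy t / y t)\<^sup>2 \<le> (v + \<Psi>' t) * (dz t / z t) - \<Psi> t * (dz t / z t)\<^sup>2"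
        unfolding u_def w_def by linarith
    qed (use nz in \<open>auto intro!: integrable_continuous_real continuous_intros c\<close>)
    with y_sol_log_identity[OF V V0 y dy_def \<Psi> \<Psi>' \<Psi>1 e, of v] y_sol_log_identity[OF U U0 z dz_def \<Psi> \<Psi>' \<Psi>1 e, of v]
    have "L e \<le> v * (ln (y e) - ln (z e)) + (dy e * \<Psi> e / y e - dz e * \<Psi> e / z e)"
      unfolding L_def by (simp add: algebra_simps)
    also have "\<dots> = R e"
      using ge[of e] e by (simp add: R_def ln_div)
    finally show ?thesis .
  qed
  have Ly: "((\<lambda>t. y t / t) \<longlongrightarrow> 1) (at_right 0)" and Lz: "((\<lambda>t. z t / t) \<longlongrightarrow> 1) (at_right 0)"
    using y_sol_has_real_derivative[OF V y, of 0] y_sol_has_real_derivative[OF U z, of 0]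
    by (auto intro!: tendsto_div_at_right_0 simp: y_sol_0[OF V y] y_sol_0[OF U z])
  have L\<Psi>: "((\<lambda>t. \<Psi> t / t) \<longlongrightarrow> v) (at_right 0)"
    using \<Psi>[of 0] \<Psi>0 v by (intro tendsto_div_at_right_0) auto
  have right: "(f \<longlongrightarrow> f 0) (at_right 0)" if "continuous_on {0..1} f" for f :: "real \<Rightarrow> real"
  proof -
    have "(f \<longlongrightarrow> f 0) (at 0 within {0..1})" using that by (auto simp: continuous_on_def)
    then show ?thesis by (simp add: at_within_Icc_at_right)
  qed
  have "(R \<longlongrightarrow> v * (ln 1 - ln 1) + (1 * v / 1 - 1 * v / 1)) (at_right 0)"
    unfolding R_def using right[OF cdy] right[OF cdz]
    by (intro tendsto_intros Ly Lz L\<Psi>) (auto simp: dy_def dz_def)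
  then have limR: "(R \<longlongrightarrow> 0) (at_right 0)" by simp
  have i: "integral {e..1} (\<lambda>t. W t * \<Psi> t) = integral {0..1} (\<lambda>t. W t * \<Psi> t) - integral {0..e} (\<lambda>t. W t * \<Psi> t)"
    if "set_integrable lborel {0..1} W" "e \<in> {0..1}" for e W
    using Henstock_Kurzweil_Integration.integral_combine[of 0 e 1 "\<lambda>t. W t * \<Psi> t"] int[OF that(1) c\<Psi>] that by auto
  have "continuous_on {0..1} (\<lambda>e. v * (ln (y 1) - ln (z 1)) -
      ((integral {0..1} (\<lambda>t. V t * \<Psi> t) - integral {0..e} (\<lambda>t. V t * \<Psi> t)) - (integral {0..1} (\<lambda>t. U t * \<Psi> t) - integral {0..e} (\<lambda>t. U t * \<Psi> t))))"
    by (intro continuous_intros indefinite_integral_continuous_1 int V U c\<Psi>)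
  then have "continuous_on {0..1} L"
    by (rule continuous_on_eq) (simp only: L_def i[OF U, symmetric] i[OF V, symmetric])
  then have "(L \<longlongrightarrow> L 0) (at_right 0)" by (rule right)
  moreover have "\<forall>\<^sub>F e in at_right 0. L e \<le> R e"
    using eventually_at_right_real[of 0 "1::real"] by (auto elim!: eventually_mono intro: LR)
  ultimately have "L 0 \<le> 0" using limR by (intro tendsto_le[OF _ limR]) auto
  then show ?thesis by (simp add: L_def)
qed

text \<open>The hypothesis \<open>energy\<close> is the identity for a product \<Psi> of two
  solutions with Wronskian \<open>v\<close>, and the conclusion recovers the logarithmic derivative
  of the factor \<open>z\<close> that vanishes at 0. The linear equation for the defect
  \<open>M\<close> degenerates where \<Psi> vanishes, so a sign argument is used:
  \<open>\<Psi> (M^2)' = (\<Psi>' - v) M^2 \<le> 0\<close>, and \<open>M 0 = 0\<close>.\<close>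

lemma riccati_of_first_integral:
  fixes \<Psi> \<Psi>' \<Psi>'' U :: "real \<Rightarrow> real"
  assumes U: "continuous_on {0..1} U" and z: "y_sol U z"
    and \<Psi>: "\<And>t. t \<in> {0..1} \<Longrightarrow> (\<Psi> has_real_derivative \<Psi>' t) (at t within {0..1})"
    and \<Psi>': "\<And>t. t \<in> {0..1} \<Longrightarrow> (\<Psi>' has_real_derivative \<Psi>'' t) (at t within {0..1})"
    and \<Psi>0: "\<Psi> 0 = 0" and pos: "\<And>t. 0 < t \<Longrightarrow> t < 1 \<Longrightarrow> \<Psi> t > 0"
    and le: "\<And>t. t \<in> {0..1} \<Longrightarrow> \<Psi>' t \<le> v"
    and energy: "\<And>t. t \<in> {0..1} \<Longrightarrow> (\<Psi>' t)\<^sup>2 - 2 * \<Psi> t * \<Psi>'' t + 4 * U t * (\<Psi> t)\<^sup>2 = v\<^sup>2"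
    and t: "t \<in> {0..1}"
  shows "2 * \<Psi> t * (1 + integral {0..t} (\<lambda>s. U s * z s)) = (\<Psi>' t + v) * z t"
proof -
  have iU: "set_integrable lborel {0..1} U"
    by (rule borel_integrable_atLeastAtMost'[OF U])
  define dz where "dz = (\<lambda>t. 1 + integral {0..t} (\<lambda>s. U s * z s))"
  have cz: "continuous_on {0..1} z" and z0: "z 0 = 0" using z y_sol_0[OF iU z] by (auto simp: y_sol_def)
  have Dz: "(z has_real_derivative dz t) (at t within {0..1})" if "t \<in> {0..1}" for t
    using y_sol_has_real_derivative[OF iU z that] by (simp add: dz_def)
  have Ddz: "(dz has_real_derivative U t * z t) (at t within {0..1})" if "t \<in> {0..1}" for t
    unfolding dz_def using integral_has_real_derivative[of 0 1 "\<lambda>s. U s * z s" t] that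
    by (auto intro!: derivative_eq_intros continuous_intros U cz)
  define M where "M = (\<lambda>t. (\<Psi>' t + v) * z t - 2 * \<Psi> t * dz t)"
  define M' where "M' = (\<lambda>t. z t * (\<Psi>'' t - 2 * U t * \<Psi> t) + dz t * (v - \<Psi>' t))"
  have DM: "(M has_real_derivative M' t) (at t within {0..1})" if "t \<in> {0..1}" for t
    unfolding M_def M'_def
    by (rule derivative_eq_intros Dz[OF that] Ddz[OF that] \<Psi>[OF that] \<Psi>'[OF that] refl)+
       (simp add: algebra_simps)
  have "(M t)\<^sup>2 \<le> (M 0)\<^sup>2"
  proof (cases "t = 0")
    case False
    have "continuous_on {0..t} (\<lambda>t. (M t)\<^sup>2)"
    proof -
      have "continuous_on {0..1} M"
        using DM DERIV_continuous unfolding continuous_on_eq_continuous_within by blast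
      then show ?thesis using t by (intro continuous_intros) (auto elim: continuous_on_subset)
    qed
    moreover have "((\<lambda>t. (M t)\<^sup>2) has_derivative (\<lambda>h. 2 * M s * M' s * h)) (at s)" if "0 < s" "s < t" for s
    proof -
      have "(M has_real_derivative M' s) (at s)"
        using DM[of s] that t at_within_Icc_at[of 0 s 1] by auto
      then have "((\<lambda>t. (M t)\<^sup>2) has_real_derivative 2 * M s * M' s) (at s)"
        by (auto intro!: derivative_eq_intros)
      then show ?thesis by (simp add: has_field_derivative_def)
    qed
    \<comment> \<open>The mean value theorem evaluates the derivative at an interior point only,
      where \<Psi> is positive and can be divided out.\<close>
    ultimately obtain s where s: "0 < s" "s < t" "(M t)\<^sup>2 - (M 0)\<^sup>2 = 2 * M s * M' s * (t - 0)"
      using mvt[of 0 t "\<lambda>t. (M t)\<^sup>2" "\<lambda>s h. 2 * M s * M' s * h"] False t by auto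
    have s01: "s \<in> {0..1}" "s < 1" using s t by auto
    have "2 * \<Psi> s * M' s = (\<Psi>' s - v) * M s"
      using energy[OF s01(1)] unfolding M_def M'_def by algebra
    then have "\<Psi> s * (2 * M s * M' s) = (\<Psi>' s - v) * (M s)\<^sup>2"
      by algebra
    also have "\<dots> \<le> 0" using le[OF s01(1)] by (intro mult_nonpos_nonneg) auto
    finally have "2 * M s * M' s \<le> 0" using pos[OF s(1) s01(2)] by (simp add: mult_le_0_iff)
    then have "2 * M s * M' s * (t - 0) \<le> 0" using t by (simp add: mult_nonpos_nonneg)
    then show ?thesis using s(3) by linarith
  qed simp
  then have "M t = 0" by (simp add: M_def z0 \<Psi>0)
  then show ?thesis by (simp add: M_def dz_def)
qed

section \<open>The extremal profile\<close>

lemma has_real_derivative_max0_powr: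
  fixes a :: real
  assumes a: "a > 1"
  shows "((\<lambda>y. max 0 y powr a) has_real_derivative a * max 0 y powr (a - 1)) (at y)"
proof (cases y "0::real" rule: linorder_cases)
  case less
  have "((\<lambda>y. 0) has_real_derivative 0) (at y)" by simp
  then have "((\<lambda>y. max 0 y powr a) has_real_derivative 0) (at y)"
    by (rule has_field_derivative_transform_within_open[where S = "{..<0}"]) (use less in auto)
  then show ?thesis using less by simp
next
  case greater
  have "((\<lambda>y. y powr a) has_real_derivative a * y powr (a - 1)) (at y)"
    using greater by (intro has_real_derivative_powr) auto
  then have "((\<lambda>y. max 0 y powr a) has_real_derivative a * y powr (a - 1)) (at y)"
    by (rule has_field_derivative_transform_within_open[where S = "{0<..}"]) (use greater in auto)
  then show ?thesis using greater by simp
next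
  case equal
  have "((\<lambda>y. \<bar>y\<bar> powr (a - 1)) \<longlongrightarrow> \<bar>0\<bar> powr (a - 1)) (at 0)"
    using a by (intro tendsto_powr' tendsto_intros) auto
  then have *: "((\<lambda>y. \<bar>y\<bar> powr (a - 1)) \<longlongrightarrow> 0) (at (0::real))" by simp
  have "((\<lambda>y. max 0 y powr a / y) \<longlongrightarrow> 0) (at 0)"
  proof (rule Lim_null_comparison[OF _ *])
    have "norm (max 0 y powr a / y) \<le> \<bar>y\<bar> powr (a - 1)" for y :: real
    proof (cases "y > 0")
      case False
      then have "max 0 y = 0" by simp
      then show ?thesis by simp
    qed (simp add: powr_diff)
    then show "\<forall>\<^sub>F y in at 0. norm (max 0 y powr a / y) \<le> \<bar>y\<bar> powr (a - 1)"
      by (intro always_eventually allI)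
  qed
  then show ?thesis using equal a by (simp add: has_field_derivative_iff)
qed

lemma has_real_derivative_max0_one_minus_powr:
  fixes a :: real
  assumes "a > 1"
  shows "((\<lambda>u. max 0 (1 - u) powr a) has_real_derivative a * max 0 (1 - x) powr (a - 1) * (- 1)) (at x)"
  by (rule DERIV_chain2[OF has_real_derivative_max0_powr[OF assms]]) (auto intro!: derivative_eq_intros)

text \<open>Bernoulli's inequality, continued past \<open>u = 1\<close>. The gap has derivative
  \<open>a (1 - max 0 (1 - x) powr (a - 1))\<close>, which is nonnegative.\<close>

lemma bernoulli_max0_powr:
  fixes a u :: real
  assumes a: "a > 1" and u: "u \<ge> 0"
  shows "1 - a * u \<le> max 0 (1 - u) powr a"
proof -
  have "max 0 (1 - 0) powr a - (1 - a * 0) \<le> max 0 (1 - u) powr a - (1 - a * u)"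
  proof (rule DERIV_nonneg_imp_nondecreasing[OF u])
    fix x :: real assume x: "0 \<le> x" "x \<le> u"
    have "((\<lambda>u. max 0 (1 - u) powr a - (1 - a * u)) has_real_derivative
        a * max 0 (1 - x) powr (a - 1) * (-1) - (0 - a * 1)) (at x)"
      by (intro DERIV_diff DERIV_const DERIV_cmult DERIV_ident has_real_derivative_max0_one_minus_powr a)
    moreover have "max 0 (1 - x) powr (a - 1) \<le> 1 powr (a - 1)"
      using x a by (intro powr_mono2) auto
    then have "0 \<le> a * max 0 (1 - x) powr (a - 1) * (-1) - (0 - a * 1)"
      using a by simp
    ultimately show "\<exists>y. ((\<lambda>u. max 0 (1 - u) powr a - (1 - a * u)) has_real_derivative y) (at x) \<and> 0 \<le> y"
      by blast
  qed
  then show ?thesis by simp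
qed

text \<open>One order beyond Bernoulli: the derivative of the gap is \<open>a + 1\<close> times the
  gap in \<open>bernoulli_max0_powr\<close>.\<close>

lemma max0_powr_le_quadratic:
  fixes a u :: real
  assumes a: "a > 1" and u: "u \<ge> 0"
  shows "max 0 (1 - u) powr (a + 1) \<le> 1 - (a + 1) * u + (a + 1) * a * u\<^sup>2 / 2"
proof -
  let ?f = "\<lambda>u. 1 - (a + 1) * u + (a + 1) * a * u\<^sup>2 / 2 - max 0 (1 - u) powr (a + 1)"
  have "?f 0 \<le> ?f u"
  proof (rule DERIV_nonneg_imp_nondecreasing[OF u])
    fix x :: real assume x: "0 \<le> x" "x \<le> u"
    have "(?f has_real_derivative
        0 - (a + 1) * 1 + (a + 1) * a * (2 * x) / 2 - (a + 1) * max 0 (1 - x) powr (a + 1 - 1) * (-1)) (at x)"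
    proof (rule DERIV_diff)
      show "((\<lambda>u. 1 - (a + 1) * u + (a + 1) * a * u\<^sup>2 / 2) has_real_derivative
          0 - (a + 1) * 1 + (a + 1) * a * (2 * x) / 2) (at x)"
        by (auto intro!: derivative_eq_intros)
    qed (use a in \<open>intro has_real_derivative_max0_one_minus_powr, simp\<close>)
    moreover have "0 - (a + 1) * 1 + (a + 1) * a * (2 * x) / 2 - (a + 1) * max 0 (1 - x) powr (a + 1 - 1) * (-1)
       = (a + 1) * (max 0 (1 - x) powr a - (1 - a * x))" by (simp add: algebra_simps)
    moreover have "0 \<le> \<dots>" using bernoulli_max0_powr[OF a x(1)] a by simp
    ultimately show "\<exists>y. (?f has_real_derivative y) (at x) \<and> 0 \<le> y" by (intro exI conjI) (assumption, linarith)
  qed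
  then show ?thesis by simp
qed

text \<open>For \<open>\<Psi> = m (1 - x\<^sup>2)\<close> the energy integral of \<open>\<Psi>'' = \<Psi>\<^sup>a - 2 H\<close> says that \<open>\<Psi>'\<^sup>2\<close> is a constant multiple of
  \<open>x\<^sup>2 (\<kappa> - chord_slope a x)\<close>, where \<open>2 H = \<kappa> m\<^sup>a\<close>. Replacing \<open>1 - x\<^sup>2\<close> by its positive part keeps the function
  differentiable past the endpoints \<open>x = \<plusminus>1\<close>.\<close>
definition chord_slope :: "real \<Rightarrow> real \<Rightarrow> real" where
  "chord_slope a x = (if x = 0 then 1 else (1 - max 0 (1 - x\<^sup>2) powr (a + 1)) / ((a + 1) * x\<^sup>2))"

lemma chord_slope_mult:
  "a > 1 \<Longrightarrow> x\<^sup>2 * chord_slope a x = (1 - max 0 (1 - x\<^sup>2) powr (a + 1)) / (a + 1)"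
  by (auto simp: chord_slope_def)

text \<open>The upper bound keeps \<open>\<kappa> - chord_slope a x\<close> positive for
  \<open>\<kappa> > 1\<close>; the quadratic lower bound gives continuity at 0 and the divergence of
  the travel time as \<kappa> tends to 1.\<close>

lemma chord_slope_bounds:
  assumes a: "a > 1"
  shows "0 \<le> chord_slope a x" "chord_slope a x \<le> 1" "1 - a * x\<^sup>2 / 2 \<le> chord_slope a x"
proof -
  have 0: "0 \<le> chord_slope a x \<and> chord_slope a x \<le> 1 \<and> 1 - a * x\<^sup>2 / 2 \<le> chord_slope a x" if x: "x \<noteq> 0"
  proof -
    have p: "(a + 1) * x\<^sup>2 > 0" using x a by simp
    have "max 0 (1 - x\<^sup>2) powr (a + 1) \<le> 1 powr (a + 1)" using a by (intro powr_mono2) auto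
    then have "0 \<le> 1 - max 0 (1 - x\<^sup>2) powr (a + 1)" by simp
    moreover have "1 - max 0 (1 - x\<^sup>2) powr (a + 1) \<le> (a + 1) * x\<^sup>2"
      using bernoulli_max0_powr[of "a + 1" "x\<^sup>2"] a by simp
    moreover have "(1 - a * x\<^sup>2 / 2) * ((a + 1) * x\<^sup>2) \<le> 1 - max 0 (1 - x\<^sup>2) powr (a + 1)"
      using max0_powr_le_quadratic[OF a, of "x\<^sup>2"] by (simp add: algebra_simps power2_eq_square)
    ultimately show ?thesis
      using p x a by (simp add: chord_slope_def pos_le_divide_eq pos_divide_le_eq)
  qed
  show "0 \<le> chord_slope a x" "chord_slope a x \<le> 1" "1 - a * x\<^sup>2 / 2 \<le> chord_slope a x"
    using 0 by (cases "x = 0"; simp add: chord_slope_def)+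
qed

lemma isCont_chord_slope:
  assumes a: "a > 1"
  shows "isCont (chord_slope a) x"
proof (cases "x = 0")
  case True
  have "((\<lambda>x. 1 - a * x\<^sup>2 / 2) \<longlongrightarrow> 1 - a * 0\<^sup>2 / 2) (at 0)" by (intro tendsto_intros) auto
  then have lim: "((\<lambda>x. 1 - a * x\<^sup>2 / 2) \<longlongrightarrow> 1) (at 0)" by simp
  have "(chord_slope a \<longlongrightarrow> 1) (at 0)"
    by (rule tendsto_sandwich[OF _ _ lim tendsto_const])
       (intro always_eventually allI chord_slope_bounds[OF a])+
  then show ?thesis using True by (simp add: isCont_def chord_slope_def)
next
  case False
  have "isCont (\<lambda>y. max 0 y powr (a + 1)) z" for z
    using a by (intro DERIV_isCont[OF has_real_derivative_max0_powr]) simp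
  then have "isCont (\<lambda>x. max 0 (1 - x\<^sup>2) powr (a + 1)) x"
    by (rule isCont_o2[where f = "\<lambda>x. 1 - x\<^sup>2" and g = "\<lambda>y. max 0 y powr (a + 1)", rotated]) simp
  then have "isCont (\<lambda>x. (1 - max 0 (1 - x\<^sup>2) powr (a + 1)) / ((a + 1) * x\<^sup>2)) x"
    using False a by (intro continuous_intros) auto
  moreover have "\<forall>\<^sub>F y in nhds x. chord_slope a y = (1 - max 0 (1 - y\<^sup>2) powr (a + 1)) / ((a + 1) * y\<^sup>2)"
    using t1_space_nhds[OF False] by eventually_elim (simp add: chord_slope_def)
  ultimately show ?thesis by (subst isCont_cong)
qed

lemma continuous_on_chord_slope: "a > 1 \<Longrightarrow> continuous_on S (chord_slope a)"
  by (simp add: isCont_chord_slope continuous_at_imp_continuous_on)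

lemma chord_slope_minus: "chord_slope a (- x) = chord_slope a x"
  by (simp add: chord_slope_def)

text \<open>For \<open>x' = sqrt (\<kappa> - chord_slope a x)\<close>, the time that
  \<open>x\<close> takes from 0, the maximum of \<Psi>, to 1, where \<Psi> vanishes: half of the
  positive arch, before time is rescaled to [0,1].\<close>

definition half_time :: "real \<Rightarrow> real \<Rightarrow> real" where
  "half_time a \<kappa> = integral {0..1} (\<lambda>s. 1 / sqrt (\<kappa> - chord_slope a s))"

lemma sqrt_diff_chord_slope_pos:
  assumes "a > 1" "\<kappa> > 1"
  shows "sqrt (\<kappa> - chord_slope a x) > 0"
  using chord_slope_bounds(2)[of a x] assms by simp

lemma continuous_on_inverse_sqrt_chord_slope:
  assumes "a > 1" "\<kappa> > 1"
  shows "continuous_on S (\<lambda>s. 1 / sqrt (\<kappa> - chord_slope a s))"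
  using sqrt_diff_chord_slope_pos[OF assms] assms(1)
  by (intro continuous_intros continuous_on_chord_slope) (auto simp: less_le)

text \<open>The inverse function is the signed coordinate \<open>x\<close> in \<open>\<Psi> = m (1 - x\<^sup>2)\<close>. In this coordinate the energy
  integral has no singularity at the maximum of \<open>\<Psi>\<close>.\<close>
lemma orbit_coordinate_exists:
  assumes a: "a > 1" and \<kappa>: "\<kappa> > 1"
  shows "\<exists>X. (\<forall>t. (X has_real_derivative sqrt (\<kappa> - chord_slope a (X t))) (at t)) \<and>
    (\<forall>t. X (- t) = - X t) \<and> strict_mono X \<and> X (half_time a \<kappa>) = 1"
proof -
  define g where "g = (\<lambda>s. 1 / sqrt (\<kappa> - chord_slope a s))"
  have cg: "continuous_on S g" for S
    unfolding g_def by (rule continuous_on_inverse_sqrt_chord_slope[OF a \<kappa>])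
  have g_ge: "1 / sqrt \<kappa> \<le> g s" for s
    unfolding g_def using chord_slope_bounds(1)[OF a, of s] sqrt_diff_chord_slope_pos[OF a \<kappa>, of s]
    by (intro divide_left_mono) auto
  have g_pos: "g s > 0" for s unfolding g_def using sqrt_diff_chord_slope_pos[OF a \<kappa>, of s] by simp
  define T where "T = (\<lambda>x::real. LBINT s=0..x. g s)"
  have DT: "(T has_real_derivative g x) (at x)" for x
  proof -
    let ?b = "\<bar>x\<bar> + 1"
    have "(T has_vector_derivative g x) (at x within {- ?b..?b})"
      unfolding T_def zero_ereal_def by (intro interval_integral_FTC2 cg) auto
    then show ?thesis
      using at_within_Icc_at[of "- ?b" x ?b] by (auto simp: has_real_derivative_iff_has_vector_derivative)
  qed
  have T0: "T 0 = 0" by (simp add: T_def zero_ereal_def[symmetric])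
  have T1: "T 1 = half_time a \<kappa>"
    unfolding T_def half_time_def g_def[symmetric] zero_ereal_def one_ereal_def
    by (intro interval_integral_eq_integral borel_integrable_atLeastAtMost' cg) auto
  have contT: "continuous_on S T" for S using DERIV_isCont[OF DT] by (simp add: continuous_at_imp_continuous_on)
  have sm: "strict_mono T"
  proof (rule strict_monoI)
    show "T x < T y" if "x < y" for x y
      by (rule DERIV_pos_imp_increasing[OF that]) (intro exI conjI, rule DT, rule g_pos)
  qed
  have odd: "T (- x) = - T x" for x
  proof -
    have "((\<lambda>x. T x + T (- x)) has_real_derivative g x + g (- x) * (- 1)) (at x)" for x
      by (intro derivative_intros DT DERIV_chain2[where f = T])
    then have "((\<lambda>x. T x + T (- x)) has_real_derivative 0) (at x)" for x
      by (simp add: g_def chord_slope_minus)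
    then have "T x + T (- x) = T 0 + T (- 0)" by (intro DERIV_isconst_all) auto
    then show ?thesis using T0 by simp
  qed
  \<comment> \<open>As \<open>g\<close> is bounded below, \<open>T\<close> grows at least linearly.
    With oddness this makes it onto, so that its inverse \<open>X\<close> is defined at all
    times.\<close>
  have large: "x / sqrt \<kappa> \<le> T x" if "x \<ge> 0" for x
  proof -
    have "T 0 - 0 / sqrt \<kappa> \<le> T x - x / sqrt \<kappa>"
    proof (rule DERIV_nonneg_imp_nondecreasing[OF that])
      fix y
      have "((\<lambda>x. T x - x / sqrt \<kappa>) has_real_derivative g y - 1 / sqrt \<kappa>) (at y)"
        by (intro DERIV_diff DT DERIV_cdivide DERIV_ident)
      then show "\<exists>d. ((\<lambda>x. T x - x / sqrt \<kappa>) has_real_derivative d) (at y) \<and> 0 \<le> d"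
        using g_ge[of y] by (intro exI[of _ "g y - 1 / sqrt \<kappa>"]) simp
    qed
    then show ?thesis using T0 by simp
  qed
  have surj: "\<exists>x. T x = t" for t
  proof -
    define b where "b = \<bar>t\<bar> * sqrt \<kappa>"
    have b: "b \<ge> 0" "b / sqrt \<kappa> = \<bar>t\<bar>" using \<kappa> by (auto simp: b_def)
    have "T (- b) \<le> t" "t \<le> T b" using large[OF b(1)] b by (auto simp: odd)
    then show ?thesis using IVT'[of T "- b" t b] contT b by auto
  qed
  define X where "X = inv T"
  have XT: "X (T x) = x" for x unfolding X_def using sm strict_mono_imp_inj_on by (intro inv_f_f) auto
  have TX: "T (X t) = t" for t unfolding X_def using surj[of t] by (intro f_inv_into_f) auto
  have contX: "isCont X t" for t
  proof -
    have "isCont X (T (X t))"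
      by (rule isCont_inverse_function[where d = 1]) (use XT DERIV_isCont[OF DT] in auto)
    then show ?thesis by (simp add: TX)
  qed
  have "(X has_real_derivative sqrt (\<kappa> - chord_slope a (X t))) (at t)" for t
  proof -
    have "(X has_real_derivative inverse (g (X t))) (at t)"
      by (rule DERIV_inverse_function[where a = "t - 1" and b = "t + 1"])
         (use DT TX contX g_pos[of "X t"] in auto)
    then show ?thesis by (simp add: g_def)
  qed
  moreover have "X (- t) = - X t" for t using XT[of "- X t"] TX[of t] by (simp add: odd)
  moreover have "strict_mono X"
    using sm TX by (metis strict_mono_less strict_monoI)
  moreover have "X (half_time a \<kappa>) = 1" using XT[of 1] by (simp add: T1)
  ultimately show ?thesis by blast
qed

section \<open>Dependence of the half time on the energy parameter \<kappa>\<close>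

lemma continuous_on_half_time:
  assumes a: "a > 1"
  shows "continuous_on {1<..} (half_time a)"
proof -
  have "continuous_on {1<..} (\<lambda>\<kappa>. integral (cbox 0 1) (\<lambda>s. 1 / sqrt (\<kappa> - chord_slope a s)))"
  proof (rule integral_continuous_on_param)
    have "continuous_on ({1<..} \<times> cbox 0 1) (\<lambda>x. 1 / sqrt (fst x - chord_slope a (snd x)))"
      using sqrt_diff_chord_slope_pos[OF a]
      by (intro continuous_intros continuous_on_compose2[OF continuous_on_chord_slope[OF a, of UNIV]]) (auto simp: less_le)
    then show "continuous_on ({1<..} \<times> cbox 0 1) (\<lambda>(\<kappa>, s). 1 / sqrt (\<kappa> - chord_slope a s))"
      by (simp add: case_prod_beta)
  qed
  then show ?thesis by (simp add: half_time_def)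
qed

lemma half_time_pos:
  assumes a: "a > 1" and \<kappa>: "\<kappa> > 1"
  shows "half_time a \<kappa> > 0"
proof -
  have "integral {0..1} (\<lambda>s::real. 1 / sqrt \<kappa>) \<le> half_time a \<kappa>"
    unfolding half_time_def
  proof (rule integral_le)
    show "1 / sqrt \<kappa> \<le> 1 / sqrt (\<kappa> - chord_slope a s)" for s
      using chord_slope_bounds(1)[OF a, of s] sqrt_diff_chord_slope_pos[OF a \<kappa>, of s]
      by (intro divide_left_mono) auto
  qed (auto intro!: integrable_continuous_real continuous_on_inverse_sqrt_chord_slope a \<kappa>)
  then show ?thesis using \<kappa> by (simp add: less_le_trans[of 0 "1 / sqrt \<kappa>"])
qed

lemma half_time_le:
  assumes a: "a > 1" and \<kappa>: "\<kappa> > 1"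
  shows "half_time a \<kappa> \<le> 1 / sqrt (\<kappa> - 1)"
proof -
  have "half_time a \<kappa> \<le> integral {0..1} (\<lambda>s::real. 1 / sqrt (\<kappa> - 1))"
    unfolding half_time_def
  proof (rule integral_le)
    show "1 / sqrt (\<kappa> - chord_slope a s) \<le> 1 / sqrt (\<kappa> - 1)" for s
      using chord_slope_bounds(2)[OF a, of s] sqrt_diff_chord_slope_pos[OF a \<kappa>, of s] \<kappa>
      by (intro divide_left_mono) auto
  qed (auto intro!: integrable_continuous_real continuous_on_inverse_sqrt_chord_slope a \<kappa>)
  then show ?thesis by simp
qed

text \<open>At \<open>\<kappa> = 1\<close> the point \<open>x = 0\<close> is an equilibrium, and the
  time diverges logarithmically on approach: for \<open>\<kappa> = 1 + d^2\<close> the integrand is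
  at least \<open>1 / (d + a s)\<close>, whose integral is
  \<open>ln ((d + a) / d) / a\<close>.\<close>

lemma half_time_unbounded:
  assumes a: "a > 1" and N: "N \<ge> 0"
  shows "\<exists>\<kappa>. 1 < \<kappa> \<and> \<kappa> \<le> 2 \<and> N \<le> half_time a \<kappa>"
proof -
  \<comment> \<open>Chosen so that \<open>- ln d / a = N\<close>.\<close>
  define d where "d = exp (- (a * N))"
  have d: "0 < d" "d \<le> 1" using a N by (auto simp: d_def)
  define \<kappa> where "\<kappa> = 1 + d\<^sup>2"
  have "d\<^sup>2 \<le> 1\<^sup>2" using d by (intro power_mono) auto
  then have \<kappa>: "1 < \<kappa>" "\<kappa> \<le> 2" using d by (auto simp: \<kappa>_def)
  have pos: "d + a * s > 0" if "s \<ge> 0" for s using d a that by (simp add: add_pos_nonneg)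
  have I: "((\<lambda>s. 1 / (d + a * s)) has_integral (ln (d + a * 1) / a - ln (d + a * 0) / a)) {0..1}"
  proof (rule fundamental_theorem_of_calculus)
    fix x :: real assume "x \<in> {0..1}"
    then have "((\<lambda>s. ln (d + a * s) / a) has_real_derivative 1 / (d + a * x) * a / a) (at x within {0..1})"
      using pos[of x] a by (auto intro!: derivative_eq_intros)
    then show "((\<lambda>s. ln (d + a * s) / a) has_vector_derivative 1 / (d + a * x)) (at x within {0..1})"
      using a by (simp add: has_real_derivative_iff_has_vector_derivative)
  qed simp
  have "ln (d + a) \<ge> 0" using d a by simp
  moreover have "ln d = - (a * N)" by (simp add: d_def)
  ultimately have "N \<le> integral {0..1} (\<lambda>s. 1 / (d + a * s))"
    unfolding integral_unique[OF I] using a by (simp add: diff_divide_distrib[symmetric] pos_le_divide_eq mult.commute)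
  also have "\<dots> \<le> half_time a \<kappa>"
    unfolding half_time_def
  proof (rule integral_le)
    show "(\<lambda>s. 1 / (d + a * s)) integrable_on {0..1}" using I by blast
    show "(\<lambda>s. 1 / sqrt (\<kappa> - chord_slope a s)) integrable_on {0..1}"
      by (intro integrable_continuous_real continuous_on_inverse_sqrt_chord_slope a \<kappa>)
    fix s :: real assume s: "s \<in> {0..1}"
    have "\<kappa> - chord_slope a s \<le> d\<^sup>2 + a * s\<^sup>2 / 2"
      using chord_slope_bounds(3)[OF a, of s] by (simp add: \<kappa>_def)
    also have "\<dots> \<le> (d + a * s)\<^sup>2"
    proof -
      have "a * s\<^sup>2 \<le> a * (a * s\<^sup>2)" using a s by (intro mult_left_mono) (auto simp: mult_le_cancel_right1)
      moreover have "0 \<le> a * s\<^sup>2" "0 \<le> d * (a * s)" using a s d by auto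
      ultimately show ?thesis by (simp add: power2_sum power_mult_distrib power2_eq_square[of a] algebra_simps)
    qed
    finally have "sqrt (\<kappa> - chord_slope a s) \<le> d + a * s"
      using pos[of s] s by (intro real_le_lsqrt) auto
    then show "1 / (d + a * s) \<le> 1 / sqrt (\<kappa> - chord_slope a s)"
      using sqrt_diff_chord_slope_pos[OF a \<kappa>(1), of s] pos[of s] s by (intro divide_left_mono) auto
  qed
  finally show ?thesis using \<kappa> by blast
qed

text \<open>Up to the factor \<open>- 4 m \<tau>\<close> this product is \<open>\<Psi>'\<close>, so
  its derivative yields the differential equation. Away from 0 it is
  \<open>sgn x * sqrt (Q x)\<close> with an explicit \<open>Q\<close>; at 0, where only continuity
  of \<open>chord_slope\<close> is at hand, the difference quotient is
  \<open>sqrt (\<kappa> - chord_slope a x)\<close> itself.\<close>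

lemma has_real_derivative_mult_sqrt_chord_slope:
  assumes a: "a > 1" and \<kappa>: "\<kappa> > 1"
  shows "((\<lambda>x. x * sqrt (\<kappa> - chord_slope a x)) has_real_derivative
     (\<kappa> - max 0 (1 - x\<^sup>2) powr a) / sqrt (\<kappa> - chord_slope a x)) (at x)"
proof (cases "x = 0")
  case True
  have "((\<lambda>x. sqrt (\<kappa> - chord_slope a x)) \<longlongrightarrow> sqrt (\<kappa> - chord_slope a 0)) (at 0)"
    using isCont_chord_slope[OF a, of 0] by (intro tendsto_intros) (simp add: isCont_def)
  then have "((\<lambda>x. (x * sqrt (\<kappa> - chord_slope a x) - 0) / (x - 0)) \<longlongrightarrow> sqrt (\<kappa> - chord_slope a 0)) (at 0)"
    by (rule Lim_transform_eventually) (auto simp: eventually_at_filter)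
  then show ?thesis using True \<kappa> by (simp add: has_field_derivative_iff chord_slope_def real_div_sqrt)
next
  case False
  define Q where "Q = (\<lambda>x. \<kappa> * x\<^sup>2 - (1 - max 0 (1 - x\<^sup>2) powr (a + 1)) / (a + 1))"
  have Q: "Q y = y\<^sup>2 * (\<kappa> - chord_slope a y)" for y
    using chord_slope_mult[OF a, of y] by (simp add: Q_def algebra_simps)
  have Qpos: "Q y > 0" if "y \<noteq> 0" for y
    using that sqrt_diff_chord_slope_pos[OF a \<kappa>, of y] by (simp add: Q)
  have DQ: "(Q has_real_derivative 2 * x * (\<kappa> - max 0 (1 - x\<^sup>2) powr a)) (at x)"
  proof -
    have "((\<lambda>x. max 0 (1 - x\<^sup>2) powr (a + 1)) has_real_derivative (a + 1) * max 0 (1 - x\<^sup>2) powr (a + 1 - 1) * (- 1) * (2 * x)) (at x)"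
      using a by (intro DERIV_chain2[where f = "\<lambda>u. max 0 (1 - u) powr (a + 1)" and g = "\<lambda>x. x\<^sup>2"]
          has_real_derivative_max0_one_minus_powr) (auto intro!: derivative_eq_intros)
    then have "(Q has_real_derivative \<kappa> * (2 * x) - (0 - (a + 1) * max 0 (1 - x\<^sup>2) powr (a + 1 - 1) * (- 1) * (2 * x)) / (a + 1)) (at x)"
      unfolding Q_def by (intro DERIV_diff DERIV_cdivide DERIV_const DERIV_cmult) (auto intro!: derivative_eq_intros)
    moreover have "\<kappa> * (2 * x) - (0 - (a + 1) * max 0 (1 - x\<^sup>2) powr (a + 1 - 1) * (- 1) * (2 * x)) / (a + 1)
        = 2 * x * (\<kappa> - max 0 (1 - x\<^sup>2) powr a)"
      using a by (simp add: field_simps)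
    ultimately show ?thesis by simp
  qed
  have sq: "sqrt (Q y) = \<bar>y\<bar> * sqrt (\<kappa> - chord_slope a y)" for y by (simp add: Q real_sqrt_mult)
  have "((\<lambda>y. sgn x * sqrt (Q y)) has_real_derivative
      sgn x * (2 * x * (\<kappa> - max 0 (1 - x\<^sup>2) powr a) * (inverse (sqrt (Q x)) / 2))) (at x)"
    using DERIV_chain2[OF DERIV_real_sqrt[OF Qpos[OF False]] DQ] by (intro DERIV_cmult) (simp add: mult.commute)
  then have "((\<lambda>x. x * sqrt (\<kappa> - chord_slope a x)) has_real_derivative
      sgn x * (2 * x * (\<kappa> - max 0 (1 - x\<^sup>2) powr a) * (inverse (sqrt (Q x)) / 2))) (at x)"
  proof (rule has_field_derivative_transform_within_open[where S = "{y. 0 < y * x}"])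
    show "open {y. 0 < y * x}" by (intro open_Collect_less continuous_intros)
    show "x \<in> {y. 0 < y * x}" using False by (simp add: zero_less_mult_iff linorder_neq_iff disj_commute)
    fix y assume "y \<in> {y. 0 < y * x}"
    then have "sgn x * \<bar>y\<bar> = y" by (auto simp: zero_less_mult_iff)
    then show "sgn x * sqrt (Q y) = y * sqrt (\<kappa> - chord_slope a y)"
      by (simp add: sq mult.assoc[symmetric])
  qed
  moreover have "sgn x * (2 * x * (\<kappa> - max 0 (1 - x\<^sup>2) powr a) * (inverse (sqrt (Q x)) / 2))
      = (\<kappa> - max 0 (1 - x\<^sup>2) powr a) / sqrt (\<kappa> - chord_slope a x)"
  proof -
    define N s where "N = \<kappa> - max 0 (1 - x\<^sup>2) powr a" and "s = sqrt (\<kappa> - chord_slope a x)"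
    have "s > 0" unfolding s_def by (rule sqrt_diff_chord_slope_pos[OF a \<kappa>])
    then have "sgn x * (2 * x * N * (inverse (\<bar>x\<bar> * s) / 2)) = N / s"
      using False by (cases "x > 0") (auto simp: field_simps)
    then show ?thesis by (simp add: N_def s_def sq)
  qed
  ultimately show ?thesis by simp
qed

text \<open>Writing \<open>\<tau>\<close> for \<open>half_time a \<kappa>\<close>, the amplitude \<open>m\<close> with \<open>m\<^bsup>a-1\<^esup> = 8 \<tau>\<^sup>2\<close> makes the orbit return to \<open>0\<close> at time 1,
  and the equation below is the initial slope condition \<open>\<Psi>'(0) = H - c\<close> with \<open>2 H = \<kappa> m\<^sup>a\<close>.\<close>
lemma slope_condition_solvable:
  assumes a: "a > 1" and c: "c > 0"
  shows "\<exists>\<kappa> m. \<kappa> > 1 \<and> m > 0 \<and> m powr (a - 1) = 8 * (half_time a \<kappa>)\<^sup>2 \<and>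
    \<kappa> * m powr a / 2 - 4 * m * half_time a \<kappa> * sqrt (\<kappa> - 1 / (a + 1)) = c"
proof -
  define m where "m = (\<lambda>\<kappa>. (8 * (half_time a \<kappa>)\<^sup>2) powr (1 / (a - 1)))"
  have m_pos: "m \<kappa> > 0" if "\<kappa> > 1" for \<kappa>
    using half_time_pos[OF a that] by (simp add: m_def)
  have m_powr: "m \<kappa> powr (a - 1) = 8 * (half_time a \<kappa>)\<^sup>2" for \<kappa>
    using a by (simp add: m_def powr_powr)
  have m_powr': "m \<kappa> powr a = m \<kappa> * (8 * (half_time a \<kappa>)\<^sup>2)" if "\<kappa> > 1" for \<kappa>
    using m_pos[OF that] powr_mult_base[of "m \<kappa>" "a - 1"] by (simp add: m_powr)
  define C where "C = (\<lambda>\<kappa>. 4 * m \<kappa> * half_time a \<kappa> * (\<kappa> * half_time a \<kappa> - sqrt (\<kappa> - 1 / (a + 1))))"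
  have C: "\<kappa> * m \<kappa> powr a / 2 - 4 * m \<kappa> * half_time a \<kappa> * sqrt (\<kappa> - 1 / (a + 1)) = C \<kappa>" if "\<kappa> > 1" for \<kappa>
    by (simp add: C_def m_powr'[OF that] power2_eq_square algebra_simps)
  have inv: "0 < 1 / (a + 1)" "1 / (a + 1) < 1" using a by auto
  have contC: "continuous_on {1<..} C"
    unfolding C_def m_def using half_time_pos[OF a]
    by (intro continuous_intros continuous_on_half_time a) (auto simp: less_le)
  \<comment> \<open>Near \<open>\<kappa> = 1\<close>: a half time of at least \<open>2 + c\<close>
    exceeds the root, which is at most 2, by at least \<open>c\<close>, and makes the factor in
    front of the bracket of \<open>C\<close> at least 1.\<close>
  obtain \<kappa>1 where \<kappa>1: "1 < \<kappa>1" "\<kappa>1 \<le> 2" "2 + c \<le> half_time a \<kappa>1"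
    using half_time_unbounded[OF a, of "2 + c"] c by auto
  have C1: "c \<le> C \<kappa>1"
  proof -
    define \<tau> where "\<tau> = half_time a \<kappa>1"
    have \<tau>: "2 + c \<le> \<tau>" using \<kappa>1 by (simp add: \<tau>_def)
    have "1 \<le> \<tau>\<^sup>2" using \<tau> c by (intro one_le_power) auto
    then have "1 powr (1 / (a - 1)) \<le> m \<kappa>1"
      unfolding m_def using a by (intro powr_mono2) (auto simp: \<tau>_def)
    then have m1: "1 \<le> m \<kappa>1" by simp
    have "sqrt (\<kappa>1 - 1 / (a + 1)) \<le> sqrt 4" using \<kappa>1 inv by (intro real_sqrt_le_mono) linarith
    then have "sqrt (\<kappa>1 - 1 / (a + 1)) \<le> 2" by simp
    moreover have "1 * \<tau> \<le> \<kappa>1 * \<tau>" using \<kappa>1 \<tau> c by (intro mult_right_mono) auto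
    ultimately have b: "c \<le> \<kappa>1 * \<tau> - sqrt (\<kappa>1 - 1 / (a + 1))" using \<tau> by simp
    have "1 * 1 \<le> m \<kappa>1 * \<tau>" using m1 \<tau> c by (intro mult_mono) auto
    then have "1 \<le> 4 * m \<kappa>1 * \<tau>" by simp
    then have "1 * c \<le> 4 * m \<kappa>1 * \<tau> * (\<kappa>1 * \<tau> - sqrt (\<kappa>1 - 1 / (a + 1)))"
      using b c by (intro mult_mono) (assumption | linarith)+
    then show ?thesis by (simp add: C_def \<tau>_def)
  qed
  define B where "B = (8::real) powr (1 / (a - 1))"
  have B: "B > 0" by (simp add: B_def)
  \<comment> \<open>For large \<kappa>: with \<open>r = sqrt (\<kappa>2 - 1)\<close> the bracket of
    \<open>C\<close> is at most \<open>1 / r\<close> and \<open>m\<close> is at most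
    \<open>B\<close>, so \<open>C \<kappa>2 \<le> 4 B / r\<close>; this choice gives
    \<open>r \<ge> 4 B / c\<close>.\<close>
  define \<kappa>2 where "\<kappa>2 = 2 + (4 * B / c)\<^sup>2"
  have \<kappa>2: "\<kappa>2 \<ge> 2" by (simp add: \<kappa>2_def)
  have C2: "C \<kappa>2 \<le> c"
  proof -
    define \<tau> where "\<tau> = half_time a \<kappa>2"
    have \<tau>0: "\<tau> > 0" unfolding \<tau>_def using \<kappa>2 by (intro half_time_pos a) auto
    have \<tau>le: "\<tau> \<le> 1 / sqrt (\<kappa>2 - 1)" unfolding \<tau>_def using \<kappa>2 by (intro half_time_le a) auto
    define r where "r = sqrt (\<kappa>2 - 1)"
    have r1: "r \<ge> 1" using \<kappa>2 by (simp add: r_def)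
    have rB: "4 * B / c \<le> r" unfolding r_def by (intro real_le_rsqrt) (simp add: \<kappa>2_def)
    have r2: "r\<^sup>2 = \<kappa>2 - 1" using \<kappa>2 by (simp add: r_def)
    have "1 / r \<le> 1" using r1 by simp
    then have \<tau>1: "\<tau> \<le> 1" using \<tau>le by (simp add: r_def)
    have "\<tau>\<^sup>2 \<le> 1" using \<tau>0 \<tau>1 by (simp add: power_le_one)
    then have mB: "m \<kappa>2 \<le> B" unfolding m_def B_def using a by (intro powr_mono2) (auto simp: \<tau>_def)
    have "r \<le> sqrt (\<kappa>2 - 1 / (a + 1))" unfolding r_def using inv by (intro real_sqrt_le_mono) linarith
    moreover have "\<kappa>2 * \<tau> \<le> \<kappa>2 * (1 / r)" using \<tau>le \<kappa>2 by (intro mult_left_mono) (auto simp: r_def)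
    moreover have "\<kappa>2 * (1 / r) - r = 1 / r" using r1 r2 by (simp add: field_simps power2_eq_square)
    ultimately have b: "\<kappa>2 * \<tau> - sqrt (\<kappa>2 - 1 / (a + 1)) \<le> 1 / r" by linarith
    have m0: "m \<kappa>2 > 0" using m_pos \<kappa>2 by simp
    have "C \<kappa>2 \<le> 4 * m \<kappa>2 * \<tau> * (1 / r)"
      unfolding C_def \<tau>_def[symmetric] using b m0 \<tau>0 by (intro mult_left_mono) auto
    also have "\<dots> \<le> 4 * B * 1 * (1 / r)"
      using mB m0 \<tau>0 \<tau>1 r1 B by (intro mult_mono) auto
    also have "\<dots> \<le> c" using rB r1 c by (simp add: field_simps)
    finally show ?thesis .
  qed
  have "continuous_on {\<kappa>1..\<kappa>2} C" by (rule continuous_on_subset[OF contC]) (use \<kappa>1 in auto)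
  then obtain \<kappa> where \<kappa>: "\<kappa>1 \<le> \<kappa>" "C \<kappa> = c"
    using IVT2'[of C \<kappa>2 c \<kappa>1] C1 C2 \<kappa>1 \<kappa>2 by auto
  then have "\<kappa> > 1" using \<kappa>1 by simp
  then show ?thesis using m_pos m_powr C \<kappa>(2) by (intro exI[of _ \<kappa>] exI[of _ "m \<kappa>"]) auto
qed

text \<open>With \<open>x' = 2 \<tau> sqrt (\<kappa> - chord_slope a x)\<close> the chain rule gives
  \<open>\<Psi>'' = 8 m \<tau>^2 (max 0 (1 - x^2) powr a - \<kappa>)\<close>, which is the required
  equation because \<open>m^a = 8 m \<tau>^2\<close>. The energy law and the bound on
  \<open>\<Psi>'\<close> are what \<open>riccati_of_first_integral\<close> asks for.\<close>

lemma psi_profile_exists: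
  assumes a: "a > 1" and c: "c > 0"
  shows "\<exists>H \<Psi> \<Psi>'. H > c \<and>
    (\<forall>t. (\<Psi> has_real_derivative \<Psi>' t) (at t)) \<and>
    (\<forall>t. (\<Psi>' has_real_derivative max 0 (\<Psi> t) powr a - 2 * H) (at t)) \<and>
    \<Psi> 0 = 0 \<and> \<Psi>' 0 = H - c \<and> \<Psi>' 1 = - (H - c) \<and> (\<forall>t. \<Psi> (1 - t) = \<Psi> t) \<and>
    strict_mono_on {0..1/2} \<Psi> \<and> (\<forall>t\<in>{0<..<1}. \<Psi> t > 0) \<and> (\<forall>t\<in>{0..1}. \<Psi>' t \<le> H - c) \<and>
    (\<forall>t\<in>{0..1}. (\<Psi>' t)\<^sup>2 = (H - c)\<^sup>2 - 4 * H * \<Psi> t + 2 * \<Psi> t powr (a + 1) / (a + 1))"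
proof -
  obtain \<kappa> m where \<kappa>: "\<kappa> > 1" and m: "m > 0" and m_powr: "m powr (a - 1) = 8 * (half_time a \<kappa>)\<^sup>2"
    and slope: "\<kappa> * m powr a / 2 - 4 * m * half_time a \<kappa> * sqrt (\<kappa> - 1 / (a + 1)) = c"
    using slope_condition_solvable[OF a c] by auto
  define \<tau> where "\<tau> = half_time a \<kappa>"
  have \<tau>: "\<tau> > 0" unfolding \<tau>_def by (rule half_time_pos[OF a \<kappa>])
  have ma: "m powr a = 8 * m * \<tau>\<^sup>2"
    using m powr_mult_base[of m "a - 1"] by (simp add: m_powr \<tau>_def)
  obtain X where DX: "\<And>t. (X has_real_derivative sqrt (\<kappa> - chord_slope a (X t))) (at t)"
    and Xodd: "\<And>t. X (- t) = - X t" and Xmono: "strict_mono X" and X\<tau>: "X \<tau> = 1"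
    using orbit_coordinate_exists[OF a \<kappa>] unfolding \<tau>_def by blast
  \<comment> \<open>Affine change of time: \<open>x\<close> runs from -1 at time 0 through 0 at time
    1/2 to 1 at time 1, and oddness of \<open>X\<close> becomes symmetry of \<Psi> about
    1/2.\<close>
  define x where "x = (\<lambda>t. X (\<tau> * (2 * t - 1)))"
  define S where "S = (\<lambda>x. x * sqrt (\<kappa> - chord_slope a x))"
  define H where "H = \<kappa> * m powr a / 2"
  define \<Psi> where "\<Psi> = (\<lambda>t. m * (1 - (x t)\<^sup>2))"
  define \<Psi>' where "\<Psi>' = (\<lambda>t. - 4 * m * \<tau> * S (x t))"
  have Dx: "(x has_real_derivative sqrt (\<kappa> - chord_slope a (x t)) * (\<tau> * 2)) (at t)" for t
    unfolding x_def by (rule DERIV_chain2[OF DX]) (auto intro!: derivative_eq_intros)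
  have D\<Psi>: "(\<Psi> has_real_derivative \<Psi>' t) (at t)" for t
    unfolding \<Psi>_def \<Psi>'_def S_def
    by (rule derivative_eq_intros Dx refl)+ (simp add: algebra_simps)
  have max\<Psi>: "max 0 (\<Psi> t) = m * max 0 (1 - (x t)\<^sup>2)" for t
    using m by (simp add: \<Psi>_def max_mult_distrib_left)
  have D\<Psi>': "(\<Psi>' has_real_derivative max 0 (\<Psi> t) powr a - 2 * H) (at t)" for t
  proof -
    let ?s = "sqrt (\<kappa> - chord_slope a (x t))"
    have "((\<lambda>t. S (x t)) has_real_derivative (\<kappa> - max 0 (1 - (x t)\<^sup>2) powr a) / ?s * (?s * (\<tau> * 2))) (at t)"
      unfolding S_def by (rule DERIV_chain2[OF has_real_derivative_mult_sqrt_chord_slope[OF a \<kappa>] Dx])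
    then have "(\<Psi>' has_real_derivative - 4 * m * \<tau> * ((\<kappa> - max 0 (1 - (x t)\<^sup>2) powr a) / ?s * (?s * (\<tau> * 2)))) (at t)"
      unfolding \<Psi>'_def by (rule DERIV_cmult)
    moreover have "- 4 * m * \<tau> * ((\<kappa> - max 0 (1 - (x t)\<^sup>2) powr a) / ?s * (?s * (\<tau> * 2))) = max 0 (\<Psi> t) powr a - 2 * H"
    proof -
      have "(\<kappa> - max 0 (1 - (x t)\<^sup>2) powr a) / ?s * (?s * (\<tau> * 2)) = (\<kappa> - max 0 (1 - (x t)\<^sup>2) powr a) * (\<tau> * 2)"
        using sqrt_diff_chord_slope_pos[OF a \<kappa>, of "x t"] by simp
      then show ?thesis
        using m by (simp only:) (simp add: max\<Psi> powr_mult ma H_def power2_eq_square algebra_simps)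
    qed
    ultimately show ?thesis by simp
  qed
  have x0: "x 0 = - 1" and x1: "x 1 = 1" using Xodd[of \<tau>] by (auto simp: x_def X\<tau>)
  have xmono: "x s < x t" if "s < t" for s t
    unfolding x_def using that \<tau> by (intro strict_monoD[OF Xmono] mult_strict_left_mono) auto
  have X0: "X 0 = 0" using Xodd[of 0] by simp
  have xhalf: "x (1/2) = 0" by (simp add: x_def X0)
  have R1: "chord_slope a 1 = 1 / (a + 1)" by (simp add: chord_slope_def)
  have Hc: "H - c = 4 * m * \<tau> * sqrt (\<kappa> - 1 / (a + 1))" using slope by (simp add: H_def \<tau>_def)
  have S1: "S 1 = sqrt (\<kappa> - 1 / (a + 1))" and Sm1: "S (- 1) = - sqrt (\<kappa> - 1 / (a + 1))"
    by (auto simp: S_def R1 chord_slope_minus)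
  have x_le: "(x t)\<^sup>2 \<le> 1" if "t \<in> {0..1}" for t
  proof -
    have "x 0 \<le> x t" "x t \<le> x 1" using that xmono[of 0 t] xmono[of t 1] by force+
    then show ?thesis using x0 x1 by (simp add: abs_square_le_1 abs_le_iff)
  qed
  have energy: "(\<Psi>' t)\<^sup>2 = (H - c)\<^sup>2 - 4 * H * \<Psi> t + 2 * \<Psi> t powr (a + 1) / (a + 1)" if t: "t \<in> {0..1}" for t
  proof -
    have q: "0 \<le> \<kappa> - chord_slope a (x t)" using sqrt_diff_chord_slope_pos[OF a \<kappa>, of "x t"] by simp
    have "0 \<le> \<kappa> - chord_slope a 1" using sqrt_diff_chord_slope_pos[OF a \<kappa>, of 1] by simp
    then have q1: "0 \<le> \<kappa> - 1 / (a + 1)" by (simp add: R1)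
    define E where "E = (1 - (x t)\<^sup>2) powr (a + 1) / (a + 1)"
    have "(S (x t))\<^sup>2 = (x t)\<^sup>2 * \<kappa> - (x t)\<^sup>2 * chord_slope a (x t)"
      using q by (simp add: S_def power_mult_distrib algebra_simps)
    also have "\<dots> = (x t)\<^sup>2 * \<kappa> - 1 / (a + 1) + E"
      using x_le[OF t] by (simp add: chord_slope_mult[OF a] E_def diff_divide_distrib max_def)
    finally have S2: "(S (x t))\<^sup>2 = (x t)\<^sup>2 * \<kappa> - 1 / (a + 1) + E" .
    have "\<Psi> t powr (a + 1) = m powr (a + 1) * (1 - (x t)\<^sup>2) powr (a + 1)"
      unfolding \<Psi>_def using m x_le[OF t] by (simp add: powr_mult)
    also have "m powr (a + 1) = 8 * m\<^sup>2 * \<tau>\<^sup>2"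
      using powr_mult_base[of m a] m by (simp add: ma power2_eq_square add.commute)
    finally have P: "\<Psi> t powr (a + 1) / (a + 1) = 8 * m\<^sup>2 * \<tau>\<^sup>2 * E" by (simp add: E_def)
    have L: "(\<Psi>' t)\<^sup>2 = 16 * m\<^sup>2 * \<tau>\<^sup>2 * ((x t)\<^sup>2 * \<kappa> - 1 / (a + 1) + E)"
      unfolding S2[symmetric] by (simp add: \<Psi>'_def power_mult_distrib)
    have HH: "(H - c)\<^sup>2 = 16 * m\<^sup>2 * \<tau>\<^sup>2 * (\<kappa> - 1 / (a + 1))"
      unfolding Hc using q1 by (simp add: power_mult_distrib)
    have H4: "4 * H * \<Psi> t = 16 * m\<^sup>2 * \<tau>\<^sup>2 * (\<kappa> * (1 - (x t)\<^sup>2))"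
      by (simp add: H_def ma \<Psi>_def power2_eq_square algebra_simps)
    have "2 * \<Psi> t powr (a + 1) / (a + 1) = 16 * m\<^sup>2 * \<tau>\<^sup>2 * E" using P by simp
    then show ?thesis unfolding L HH H4 by (simp add: algebra_simps)
  qed
  have Hc0: "H - c > 0"
    using sqrt_diff_chord_slope_pos[OF a \<kappa>, of 1] m \<tau> unfolding Hc R1 by (intro mult_pos_pos) auto
  have H0: "H > 0" using Hc0 c by simp
  have \<Psi>nonneg: "\<Psi> t \<ge> 0" if "t \<in> {0..1}" for t using x_le[OF that] m by (simp add: \<Psi>_def)
  \<comment> \<open>From \<open>\<Psi> \<le> m\<close> and \<open>\<kappa> > 1\<close> follows
    \<open>\<Psi> powr a \<le> 2 H\<close>, so in the energy law the power term is dominated by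
    \<open>4 H \<Psi>\<close>.\<close>
  have \<Psi>'le: "\<Psi>' t \<le> H - c" if t: "t \<in> {0..1}" for t
  proof -
    have "\<Psi> t \<le> m" using m by (simp add: \<Psi>_def)
    then have "\<Psi> t powr a \<le> m powr a" using a \<Psi>nonneg[OF t] by (intro powr_mono2) auto
    also have "\<dots> \<le> \<kappa> * m powr a" using \<kappa> mult_right_mono[of 1 \<kappa> "m powr a"] by simp
    finally have "\<Psi> t * \<Psi> t powr a \<le> \<Psi> t * (2 * H)"
      using \<Psi>nonneg[OF t] by (intro mult_left_mono) (auto simp: H_def)
    then have le: "\<Psi> t powr (a + 1) \<le> 2 * H * \<Psi> t"
      using powr_mult_base[of "\<Psi> t" a] \<Psi>nonneg[OF t] by (simp add: mult.commute add.commute)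
    have "\<Psi> t powr (a + 1) / (a + 1) \<le> \<Psi> t powr (a + 1)" using a by (simp add: divide_le_eq mult_le_cancel_left1)
    then have "(\<Psi>' t)\<^sup>2 \<le> (H - c)\<^sup>2" unfolding energy[OF t] using le by simp
    then show ?thesis by (rule power2_le_imp_le) (use Hc0 in simp)
  qed
  have sm: "strict_mono_on {0..1/2} \<Psi>"
  proof (rule strict_mono_onI)
    fix s t :: real assume st: "s \<in> {0..1/2}" "t \<in> {0..1/2}" "s < t"
    have "t = 1/2 \<or> t < 1/2" using st by auto
    then have "x t \<le> 0" using xmono[of t "1/2"] unfolding xhalf by (elim disjE) (simp_all only: xhalf order_refl less_imp_le)
    moreover have "x s < x t" by (rule xmono[OF st(3)])
    ultimately have "(- x t)\<^sup>2 < (- x s)\<^sup>2" by (intro power_strict_mono) auto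
    then show "\<Psi> s < \<Psi> t" using m by (simp add: \<Psi>_def)
  qed
  have pos: "\<Psi> t > 0" if "t \<in> {0<..<1}" for t
  proof -
    have "- 1 < x t" "x t < 1" using that xmono[of 0 t] xmono[of t 1] x0 x1 by auto
    then have "(x t)\<^sup>2 < 1" by (simp add: abs_square_less_1 abs_less_iff)
    then show ?thesis using m by (simp add: \<Psi>_def)
  qed
  have sym: "\<Psi> (1 - t) = \<Psi> t" for t
    using Xodd[of "\<tau> * (2 * t - 1)"] by (simp add: \<Psi>_def x_def algebra_simps)
  have "\<Psi> 0 = 0" "\<Psi>' 0 = H - c" "\<Psi>' 1 = - (H - c)"
    unfolding Hc by (simp_all add: \<Psi>_def \<Psi>'_def x0 x1 S1 Sm1)
  moreover have "H > c" using Hc0 by simp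
  ultimately show ?thesis
    using D\<Psi> D\<Psi>' \<Psi>'le sm pos sym energy by blast
qed

section \<open>Maximality\<close>

text \<open>Strict convexity, through the mean value theorem for \<open>max 0 y powr q\<close>,
  which admits 0 for both arguments. Strictness is what makes the maximizer unique.\<close>

lemma powr_tangent_strict:
  fixes u w q :: real
  assumes q: "q > 1" and u: "u \<ge> 0" and w: "w \<ge> 0" and ne: "w \<noteq> u"
  shows "q * u powr (q - 1) * (w - u) < w powr q - u powr q"
proof -
  note D = has_real_derivative_max0_powr[OF q]
  show ?thesis
  proof (cases "u < w")
    case True
    then obtain \<xi> where \<xi>: "u < \<xi>" "\<xi> < w" "max 0 w powr q - max 0 u powr q = (w - u) * (q * max 0 \<xi> powr (q - 1))"
      using MVT2[OF True D] by blast
    have "u powr (q - 1) < \<xi> powr (q - 1)" using \<xi> u q by (intro powr_less_mono2) auto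
    then have "q * u powr (q - 1) * (w - u) < q * \<xi> powr (q - 1) * (w - u)" using True q by simp
    then show ?thesis using \<xi> u w by (simp add: mult.commute)
  next
    case False
    then have lt: "w < u" using ne by simp
    then obtain \<xi> where \<xi>: "w < \<xi>" "\<xi> < u" "max 0 u powr q - max 0 w powr q = (u - w) * (q * max 0 \<xi> powr (q - 1))"
      using MVT2[OF lt D] by blast
    have "\<xi> powr (q - 1) < u powr (q - 1)" using \<xi> w q by (intro powr_less_mono2) auto
    then have "q * \<xi> powr (q - 1) * (u - w) < q * u powr (q - 1) * (u - w)" using lt q by simp
    then show ?thesis using \<xi> u w by (simp add: algebra_simps)
  qed
qed

lemma Lq_on01_integrable:
  assumes q: "q > 1" and V: "Lq_on01 q V"
  shows "set_integrable lborel {0..1} V"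
  unfolding set_integrable_def
proof (rule Bochner_Integration.integrable_bound)
  show "integrable lborel (\<lambda>t. indicator {0..1} t *\<^sub>R (1::real) + indicator {0..1} t *\<^sub>R (\<bar>V t\<bar> powr q))"
    using V borel_integrable_atLeastAtMost'[of 0 1 "\<lambda>_. 1::real"]
    unfolding Lq_on01_def set_integrable_def by (intro Bochner_Integration.integrable_add) auto
  show "(\<lambda>t. indicat_real {0..1} t *\<^sub>R V t) \<in> borel_measurable lborel"
    using V by (simp add: Lq_on01_def set_borel_measurable_def)
  have "\<bar>V t\<bar> \<le> 1 + \<bar>V t\<bar> powr q" for t
  proof (cases "\<bar>V t\<bar> \<le> 1")
    case False
    then have "\<bar>V t\<bar> powr 1 \<le> \<bar>V t\<bar> powr q" using q by (intro powr_mono) auto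
    then show ?thesis using False by simp
  qed (simp add: add_increasing2)
  then show "AE t in lborel. norm (indicat_real {0..1} t *\<^sub>R V t)
      \<le> norm (indicat_real {0..1} t *\<^sub>R 1 + indicat_real {0..1} t *\<^sub>R \<bar>V t\<bar> powr q)"
    by (intro AE_I2) (auto simp: indicator_def)
qed

lemma set_integral_nonneg_eq_0_AE:
  fixes f :: "real \<Rightarrow> real"
  assumes i: "set_integrable lborel S f" and nonneg: "\<And>t. t \<in> S \<Longrightarrow> 0 \<le> f t" and 0: "(LINT t:S|lborel. f t) \<le> 0"
  shows "AE t in lborel. t \<in> S \<longrightarrow> f t = 0"
proof -
  have nn: "0 \<le> indicator S t *\<^sub>R f t" for t using nonneg by (auto simp: indicator_def)
  then have "0 \<le> (LINT t:S|lborel. f t)" unfolding set_lebesgue_integral_def by (intro integral_nonneg_AE) auto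
  then have "AE t in lborel. indicator S t *\<^sub>R f t = 0"
    using integral_nonneg_eq_0_iff_AE[of lborel "\<lambda>t. indicator S t *\<^sub>R f t"] i 0 nn
    by (simp add: set_integrable_def set_lebesgue_integral_def)
  then show ?thesis by eventually_elim (auto simp: indicator_def)
qed

text \<open>\<open>Y 1 - y 1\<close> is the integral of the nonnegative function
  \<open>(1 - s) (\<bar>V\<bar> Y - V y)\<close>, so equality forces
  \<open>\<bar>V\<bar> Y = V y\<close> almost everywhere. The two Volterra equations then have the
  same right-hand side, so \<open>y = Y\<close> throughout, and \<open>Y\<close>, positive off 0,
  can be cancelled.\<close>

lemma AE_eq_abs_if_y_sol_abs_eq:
  assumes V: "set_integrable lborel {0..1} V" and y: "y_sol V y" and Y: "y_sol (\<lambda>t. \<bar>V t\<bar>) Y" and eq: "y 1 = Y 1"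
  shows "AE t in lborel. t \<in> {0..1} \<longrightarrow> V t = \<bar>V t\<bar>"
proof -
  have aV: "set_integrable lborel {0..1} (\<lambda>t. \<bar>V t\<bar>)" by (rule set_integrable_abs[OF V])
  have cy: "continuous_on {0..1} y" and cY: "continuous_on {0..1} Y" using y Y by (auto simp: y_sol_def)
  have le: "\<bar>y t\<bar> \<le> Y t" if "t \<in> {0..1}" for t
    using y_sol_abs_le[OF V aV _ y Y that] by simp
  have int: "set_integrable lborel {0..t} (\<lambda>s. (t - s) * W s * h s)"
    if "set_integrable lborel {0..1} W" "continuous_on {0..1} h" "t \<in> {0..1}" for W h :: "real \<Rightarrow> real" and t
  proof -
    have "set_integrable lborel {0..1} (\<lambda>s. W s * ((t - s) * h s))"
      by (intro set_integrable_mult_continuous_on that continuous_intros)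
    then have "set_integrable lborel {0..t} (\<lambda>s. W s * ((t - s) * h s))"
      by (rule set_integrable_subset) (use that in auto)
    then show ?thesis by (simp add: ac_simps)
  qed
  have e: "y t = t + (LINT s:{0..t}|lborel. (t - s) * V s * y s)"
    "Y t = t + (LINT s:{0..t}|lborel. (t - s) * \<bar>V s\<bar> * Y s)" if "t \<in> {0..1}" for t
    using y Y that by (auto simp: y_sol_def)
  have "AE s in lborel. s \<in> {0..1} \<longrightarrow> (1 - s) * \<bar>V s\<bar> * Y s - (1 - s) * V s * y s = 0"
  proof (rule set_integral_nonneg_eq_0_AE)
    show "set_integrable lborel {0..1} (\<lambda>s. (1 - s) * \<bar>V s\<bar> * Y s - (1 - s) * V s * y s)"
      by (intro set_integral_diff int aV V cy cY) auto
    have "(LINT s:{0..1}|lborel. (1 - s) * \<bar>V s\<bar> * Y s - (1 - s) * V s * y s) = Y 1 - y 1"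
      using e[of 1] int[OF aV cY, of 1] int[OF V cy, of 1] by (subst set_integral_diff(2)) auto
    then show "(LINT s:{0..1}|lborel. (1 - s) * \<bar>V s\<bar> * Y s - (1 - s) * V s * y s) \<le> 0" using eq by simp
    fix s :: real assume s: "s \<in> {0..1}"
    have "V s * y s \<le> \<bar>V s\<bar> * \<bar>y s\<bar>" by (metis abs_ge_self abs_mult)
    also have "\<dots> \<le> \<bar>V s\<bar> * Y s" using le[OF s] by (intro mult_left_mono) auto
    finally have "(1 - s) * (V s * y s) \<le> (1 - s) * (\<bar>V s\<bar> * Y s)" using s by (intro mult_left_mono) auto
    then show "0 \<le> (1 - s) * \<bar>V s\<bar> * Y s - (1 - s) * V s * y s" by (simp add: mult.assoc)
  qed
  \<comment> \<open>The point 1, where the weight \<open>1 - s\<close> vanishes, is discarded as a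
    null set.\<close>
  then have ae: "AE s in lborel. s \<in> {0..1} \<longrightarrow> \<bar>V s\<bar> * Y s = V s * y s"
    using AE_lborel_singleton[of 1] by eventually_elim auto
  have yY: "y t = Y t" if t: "t \<in> {0..1}" for t
  proof -
    have "(LINT s:{0..t}|lborel. (t - s) * V s * y s) = (LINT s:{0..t}|lborel. (t - s) * \<bar>V s\<bar> * Y s)"
      unfolding set_lebesgue_integral_def
    proof (rule integral_cong_AE)
      show "(\<lambda>s. indicator {0..t} s *\<^sub>R ((t - s) * V s * y s)) \<in> borel_measurable lborel"
        "(\<lambda>s. indicator {0..t} s *\<^sub>R ((t - s) * \<bar>V s\<bar> * Y s)) \<in> borel_measurable lborel"
        using int[OF V cy t] int[OF aV cY t] unfolding set_integrable_def
        by (auto intro: borel_measurable_integrable)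
      show "AE s in lborel. indicator {0..t} s *\<^sub>R ((t - s) * V s * y s) = indicator {0..t} s *\<^sub>R ((t - s) * \<bar>V s\<bar> * Y s)"
        using ae by eventually_elim (use t in \<open>auto simp: indicator_def mult.assoc\<close>)
    qed
    then show ?thesis using e[OF t] by simp
  qed
  show ?thesis
    using ae AE_lborel_singleton[of 0]
  proof eventually_elim
    case (elim t)
    show ?case
    proof
      assume t: "t \<in> {0..1}"
      have "Y t > 0" using y_sol_ge[OF aV _ Y t] t elim by auto
      then show "V t = \<bar>V t\<bar>" using elim t yY[OF t] by simp
    qed
  qed
qed

text \<open>Since \<open>\<Psi>\<close> is a multiple of \<open>U\<^bsup>q-1\<^esup>\<close>, the tangent inequality for \<open>x\<^sup>q\<close> at \<open>U\<close> bounds the right-hand side of the logarithmic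
  comparison by the difference of the norms.\<close>
lemma det_T_maximal:
  fixes U \<Psi> \<Psi>' :: "real \<Rightarrow> real"
  assumes q: "q > 1" and K: "K > 0"
    and U: "continuous_on {0..1} U" and U0: "\<And>t. t \<in> {0..1} \<Longrightarrow> U t \<ge> 0"
    and normU: "(LINT t:{0..1}|lborel. U t powr q) = A powr q" and z: "y_sol U z"
    and \<Psi>: "\<And>t. t \<in> {0..1} \<Longrightarrow> (\<Psi> has_real_derivative \<Psi>' t) (at t within {0..1})"
    and \<Psi>': "continuous_on {0..1} \<Psi>'" and \<Psi>0: "\<Psi> 0 = 0" and \<Psi>1: "\<Psi> 1 = 0" and v: "v = \<Psi>' 0" "v > 0"
    and \<Psi>U: "\<And>t. t \<in> {0..1} \<Longrightarrow> \<Psi> t = K * U t powr (q - 1)"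
    and riccati: "\<And>t. t \<in> {0..1} \<Longrightarrow> 2 * \<Psi> t * (1 + integral {0..t} (\<lambda>s. U s * z s)) = (\<Psi>' t + v) * z t"
    and V: "admissible q A V"
  shows "det_T V \<le> det_T U" "det_T V = det_T U \<Longrightarrow> AE t in lborel. t \<in> {0..1} \<longrightarrow> V t = U t"
proof -
  have LqV: "Lq_on01 q V" and normV: "Lq_norm01 q V \<le> A" using V by (auto simp: admissible_def)
  have iU: "set_integrable lborel {0..1} U" by (rule borel_integrable_atLeastAtMost'[OF U])
  have iV: "set_integrable lborel {0..1} V" by (rule Lq_on01_integrable[OF q LqV])
  have aV: "set_integrable lborel {0..1} (\<lambda>t. \<bar>V t\<bar>)" by (rule set_integrable_abs[OF iV])
  have iVq: "set_integrable lborel {0..1} (\<lambda>t. \<bar>V t\<bar> powr q)" using LqV by (simp add: Lq_on01_def)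
  have iUq: "set_integrable lborel {0..1} (\<lambda>t. U t powr q)"
    using U U0 q by (intro borel_integrable_atLeastAtMost' continuous_on_powr' continuous_on_const) auto
  obtain y where y: "y_sol V y" using y_sol_exists[OF iV] by blast
  obtain Y where Y: "y_sol (\<lambda>t. \<bar>V t\<bar>) Y" using y_sol_exists[OF aV] by blast
  have c\<Psi>: "continuous_on {0..1} \<Psi>"
    using \<Psi> DERIV_continuous unfolding continuous_on_eq_continuous_within by blast
  have \<Psi>nonneg: "\<Psi> t \<ge> 0" if "t \<in> {0..1}" for t using \<Psi>U[OF that] K by simp
  have iV\<Psi>: "set_integrable lborel {0..1} (\<lambda>t. \<bar>V t\<bar> * \<Psi> t)" by (rule set_integrable_mult_continuous_on[OF aV c\<Psi>])
  have iU\<Psi>: "set_integrable lborel {0..1} (\<lambda>t. U t * \<Psi> t)" by (rule set_integrable_mult_continuous_on[OF iU c\<Psi>])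
  have "v * (ln (Y 1) - ln (z 1)) \<le> integral {0..1} (\<lambda>t. \<bar>V t\<bar> * \<Psi> t) - integral {0..1} (\<lambda>t. U t * \<Psi> t)"
    by (rule log_y_sol_comparison[OF aV _ Y iU U0 z \<Psi> \<Psi>' \<Psi>0 \<Psi>1 v(1) \<Psi>nonneg riccati]) auto
  then have log_le: "v * (ln (Y 1) - ln (z 1)) \<le> (LINT t:{0..1}|lborel. \<bar>V t\<bar> * \<Psi> t) - (LINT t:{0..1}|lborel. U t * \<Psi> t)"
    by (simp add: set_borel_integral_eq_integral(2)[OF iV\<Psi>] set_borel_integral_eq_integral(2)[OF iU\<Psi>])
  \<comment> \<open>The gap of the tangent inequality, scaled by \<open>K\<close> and rewritten
    through \<open>\<Psi> = K U powr (q - 1)\<close>. It is nonnegative and its integral is at most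
    \<open>- q v (ln (Y 1) - ln (z 1))\<close>; so it bounds \<open>Y 1\<close> by
    \<open>z 1\<close>, and in the case of equality it vanishes almost everywhere.\<close>
  define gap where "gap = (\<lambda>t. (K * \<bar>V t\<bar> powr q - K * U t powr q) - q * (\<bar>V t\<bar> * \<Psi> t - U t * \<Psi> t))"
  have gap_eq: "gap t = K * (\<bar>V t\<bar> powr q - U t powr q - q * U t powr (q - 1) * (\<bar>V t\<bar> - U t))" if "t \<in> {0..1}" for t
    using \<Psi>U[OF that] by (simp add: gap_def algebra_simps)
  have gap_pos: "gap t > 0" if "t \<in> {0..1}" "\<bar>V t\<bar> \<noteq> U t" for t
    using powr_tangent_strict[OF q U0[OF that(1)] abs_ge_zero that(2)] K unfolding gap_eq[OF that(1)] by simp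
  have gap_nonneg: "gap t \<ge> 0" if "t \<in> {0..1}" for t
    using gap_pos[OF that] gap_eq[OF that] by (cases "\<bar>V t\<bar> = U t") auto
  have igap: "set_integrable lborel {0..1} gap"
    unfolding gap_def by (intro set_integral_diff set_integrable_mult_right iVq iUq iV\<Psi> iU\<Psi>)
  have gap_int: "(LINT t:{0..1}|lborel. gap t) = (K * (LINT t:{0..1}|lborel. \<bar>V t\<bar> powr q) - K * A powr q)
      - q * ((LINT t:{0..1}|lborel. \<bar>V t\<bar> * \<Psi> t) - (LINT t:{0..1}|lborel. U t * \<Psi> t))"
    unfolding gap_def normU[symmetric]
    by (simp add: set_integral_diff set_integrable_mult_right iVq iUq iV\<Psi> iU\<Psi>)
  have "(LINT t:{0..1}|lborel. \<bar>V t\<bar> powr q) \<le> A powr q"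
  proof -
    have nn: "0 \<le> (LINT t:{0..1}|lborel. \<bar>V t\<bar> powr q)"
      unfolding set_lebesgue_integral_def by (intro integral_nonneg_AE) (auto simp: indicator_def)
    have "((LINT t:{0..1}|lborel. \<bar>V t\<bar> powr q) powr (1 / q)) powr q \<le> A powr q"
      using normV q unfolding Lq_norm01_def by (intro powr_mono2) auto
    then show ?thesis using q nn by (simp add: powr_powr)
  qed
  then have "K * (LINT t:{0..1}|lborel. \<bar>V t\<bar> powr q) \<le> K * A powr q" using K by simp
  then have gap_le: "(LINT t:{0..1}|lborel. gap t) \<le> - q * v * (ln (Y 1) - ln (z 1))"
    using gap_int mult_left_mono[OF log_le, of q] q by (simp add: algebra_simps)
  have gap_int_nonneg: "0 \<le> (LINT t:{0..1}|lborel. gap t)"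
    unfolding set_lebesgue_integral_def using gap_nonneg by (intro integral_nonneg_AE) (auto simp: indicator_def)
  have Y1: "Y 1 > 0" and z1: "z 1 > 0"
    using y_sol_ge[OF aV _ Y, of 1] y_sol_ge[OF iU U0 z, of 1] by auto
  have "q * v * 0 \<le> q * v * (ln (z 1) - ln (Y 1))"
    using gap_le gap_int_nonneg by (simp add: algebra_simps)
  moreover have "q * v > 0" using q v by simp
  ultimately have "0 \<le> ln (z 1) - ln (Y 1)" by (rule mult_left_le_imp_le)
  then have "ln (Y 1) \<le> ln (z 1)" by simp
  then have Yz: "Y 1 \<le> z 1" using Y1 z1 by simp
  have yY: "y 1 \<le> Y 1" using y_sol_abs_le[OF iV aV _ y Y, of 1] by auto
  have dV: "det_T V = 2 * y 1" and dU: "det_T U = 2 * z 1"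
    using det_T_eq[OF iV y] det_T_eq[OF iU z] by auto
  show "det_T V \<le> det_T U" using Yz yY dV dU by simp
  assume "det_T V = det_T U"
  then have eq: "y 1 = Y 1" "Y 1 = z 1" using Yz yY dV dU by auto
  have "AE t in lborel. t \<in> {0..1} \<longrightarrow> gap t = 0"
    using set_integral_nonneg_eq_0_AE[OF igap gap_nonneg] gap_le eq by simp
  \<comment> \<open>The gap yields only \<open>\<bar>V\<bar> = U\<close>; the sign of
    \<open>V\<close> comes from \<open>y 1 = Y 1\<close>.\<close>
  then show "AE t in lborel. t \<in> {0..1} \<longrightarrow> V t = U t"
    using AE_eq_abs_if_y_sol_abs_eq[OF iV y Y eq(1)]
    by eventually_elim (use gap_pos in force)
qed

section \<open>Regularity and endpoint behaviour\<close>

text \<open>Every iterated derivative agrees on \<open>S\<close> with a member of \<F>; openness of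
  \<open>S\<close> lets derivatives pass across such local agreement.\<close>

lemma smooth_on_derivation_closed:
  assumes S: "open S" and f: "f \<in> \<F>"
    and D: "\<And>f. f \<in> \<F> \<Longrightarrow> \<exists>f'\<in>\<F>. \<forall>t\<in>S. (f has_real_derivative f' t) (at t)"
  shows "smooth_on S f"
proof -
  have tr: "(h has_real_derivative d) (at t)"
    if "(g has_real_derivative d) (at t)" "\<forall>t\<in>S. h t = g t" "t \<in> S" for g h d t
    using that by (intro has_field_derivative_transform_within_open[OF that(1) S that(3)]) auto
  have "\<exists>g\<in>\<F>. \<forall>t\<in>S. (deriv ^^ k) f t = g t" for k
  proof (induction k)
    case 0
    then show ?case using f by auto
  next
    case (Suc k)
    then obtain g where g: "g \<in> \<F>" "\<forall>t\<in>S. (deriv ^^ k) f t = g t" by blast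
    obtain g' where g': "g' \<in> \<F>" "\<forall>t\<in>S. (g has_real_derivative g' t) (at t)" using D[OF g(1)] by blast
    have "(deriv ^^ Suc k) f t = g' t" if "t \<in> S" for t
      using DERIV_imp_deriv[OF tr[OF _ g(2) that]] g'(2) that by simp
    then show ?case using g'(1) by blast
  qed
  then have "(deriv ^^ k) f differentiable (at t)" if "t \<in> S" for k t
    using D tr that by (meson real_differentiable_def)
  then show ?thesis by (simp add: smooth_on_def)
qed

text \<open>Closed under differentiation when \<open>f' = g\<close> and
  \<open>g' = f powr a - b\<close>. The exponent of \<open>f\<close> is real because
  \<open>f\<close> is positive; that of \<open>g\<close> is a natural number because
  \<open>g\<close>, the slope of the profile, changes sign.\<close>

inductive_set monomial_sums :: "(real \<Rightarrow> real) \<Rightarrow> (real \<Rightarrow> real) \<Rightarrow> (real \<Rightarrow> real) set" for f g where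
  monomial: "(\<lambda>t. c * f t powr r * g t ^ n) \<in> monomial_sums f g"
| add: "h \<in> monomial_sums f g \<Longrightarrow> k \<in> monomial_sums f g \<Longrightarrow> (\<lambda>t. h t + k t) \<in> monomial_sums f g"

lemma smooth_on_powr_of_ode_solution:
  fixes f g :: "real \<Rightarrow> real"
  assumes S: "open S" and f: "\<And>t. t \<in> S \<Longrightarrow> (f has_real_derivative g t) (at t)"
    and g: "\<And>t. t \<in> S \<Longrightarrow> (g has_real_derivative f t powr a - b) (at t)"
    and pos: "\<And>t. t \<in> S \<Longrightarrow> f t > 0"
  shows "smooth_on S (\<lambda>t. c * f t powr r)"
proof (rule smooth_on_derivation_closed[OF S, where \<F> = "monomial_sums f g"])
  show "(\<lambda>t. c * f t powr r) \<in> monomial_sums f g" using monomial_sums.monomial[of c f r g 0] by simp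
  fix h assume "h \<in> monomial_sums f g"
  then show "\<exists>h'\<in>monomial_sums f g. \<forall>t\<in>S. (h has_real_derivative h' t) (at t)"
  proof induction
    case (monomial c r n)
    \<comment> \<open>For \<open>n = 0\<close> the truncated exponent \<open>n - 1\<close> does no
      harm: the factor \<open>n\<close> makes the terms containing it vanish.\<close>
    let ?h = "\<lambda>t. (c * r) * f t powr (r - 1) * g t ^ Suc n +
      ((c * n) * f t powr (r + a) * g t ^ (n - 1) + (- (c * n * b)) * f t powr r * g t ^ (n - 1))"
    have "((\<lambda>t. c * f t powr r * g t ^ n) has_real_derivative ?h t) (at t)" if t: "t \<in> S" for t
    proof -
      have 1: "((\<lambda>t. c * f t powr r) has_real_derivative c * (r * f t powr (r - 1) * g t)) (at t)"
        by (rule DERIV_cmult[OF DERIV_chain2[OF has_real_derivative_powr[OF pos[OF t]] f[OF t]]])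
      have 2: "((\<lambda>t. g t ^ n) has_real_derivative of_nat n * (g t ^ (n - 1)) * (f t powr a - b)) (at t)"
        using DERIV_power[OF g[OF t], of n] by (simp add: mult.commute mult.left_commute)
      show ?thesis
        using DERIV_mult[OF 1 2] by (rule DERIV_cong) (simp add: powr_add algebra_simps)
    qed
    moreover have "?h \<in> monomial_sums f g" by (intro monomial_sums.intros)
    ultimately show ?case by (intro bexI[where x = ?h]) simp_all
  next
    case (add h k)
    then obtain h' k' where "h' \<in> monomial_sums f g" "k' \<in> monomial_sums f g"
      "\<forall>t\<in>S. (h has_real_derivative h' t) (at t)" "\<forall>t\<in>S. (k has_real_derivative k' t) (at t)" by blast
    then show ?case
      by (intro bexI[of _ "\<lambda>t. h' t + k' t"]) (auto intro: DERIV_add monomial_sums.add)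
  qed
qed

text \<open>Splits the quotient into a factor tending to \<open>v powr r\<close> and the pure power
  \<open>t powr (r - 1)\<close>. With \<open>r = 1 / (q - 1)\<close> the sign of
  \<open>r - 1\<close> separates the cases \<open>q < 2\<close>, \<open>q = 2\<close> and
  \<open>q > 2\<close>.\<close>

lemma powr_quotient_eventually_eq:
  fixes f :: "real \<Rightarrow> real"
  assumes lim: "((\<lambda>t. f t / t) \<longlongrightarrow> v) (at_right 0)" and v: "v > 0"
  shows "\<forall>\<^sub>F t in at_right 0. (f t / t) powr r * t powr (r - 1) = f t powr r / t"
proof -
  have "\<forall>\<^sub>F t in at_right 0. f t / t > 0" using order_tendstoD(1)[OF lim v] .
  moreover have "\<forall>\<^sub>F t in at_right (0::real). t > 0" by (rule eventually_at_right_less)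
  ultimately show ?thesis
    by eventually_elim (auto simp: powr_divide powr_diff zero_less_divide_iff)
qed

lemma tendsto_powr_quotient_0:
  fixes f :: "real \<Rightarrow> real"
  assumes lim: "((\<lambda>t. f t / t) \<longlongrightarrow> v) (at_right 0)" and v: "v > 0" and r: "r > 1"
  shows "((\<lambda>t. f t powr r / t) \<longlongrightarrow> 0) (at_right 0)"
proof -
  have "((\<lambda>t::real. t powr (r - 1)) \<longlongrightarrow> 0 powr (r - 1)) (at_right 0)"
    using r by (intro tendsto_powr' tendsto_intros) (auto simp: eventually_at_filter)
  then have "((\<lambda>t. (f t / t) powr r * t powr (r - 1)) \<longlongrightarrow> v powr r * 0) (at_right 0)"
    using v r by (intro tendsto_mult tendsto_powr lim) auto
  then show ?thesis
    using Lim_transform_eventually[OF _ powr_quotient_eventually_eq[OF lim v]] by simp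
qed

lemma filterlim_powr_quotient_at_top:
  fixes f :: "real \<Rightarrow> real"
  assumes lim: "((\<lambda>t. f t / t) \<longlongrightarrow> v) (at_right 0)" and v: "v > 0" and r: "r < 1"
  shows "filterlim (\<lambda>t. f t powr r / t) at_top (at_right 0)"
proof -
  have "((\<lambda>t::real. t powr (1 - r)) \<longlongrightarrow> 0 powr (1 - r)) (at_right 0)"
    using r by (intro tendsto_powr' tendsto_intros) (auto simp: eventually_at_filter)
  then have "filterlim (\<lambda>t::real. inverse (t powr (1 - r))) at_top (at_right 0)"
    by (intro filterlim_inverse_at_top) (auto simp: eventually_at_filter)
  then have "filterlim (\<lambda>t::real. t powr (r - 1)) at_top (at_right 0)"
    by (simp add: powr_minus[symmetric])
  moreover have "((\<lambda>t. (f t / t) powr r) \<longlongrightarrow> v powr r) (at_right 0)" using v by (intro tendsto_intros lim) auto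
  ultimately have "filterlim (\<lambda>t. (f t / t) powr r * t powr (r - 1)) at_top (at_right 0)"
    using v by (intro filterlim_tendsto_pos_mult_at_top[where c = "v powr r"]) auto
  then show ?thesis
    by (rule filterlim_mono_eventually[OF _ order_refl order_refl powr_quotient_eventually_eq[OF lim v]])
qed

text \<open>Reflection at 1/2: with the symmetry of the potential it reduces the right endpoint to
  the left one.\<close>

lemma filterlim_at_left_1_iff:
  "filterlim f F (at_left (1::real)) \<longleftrightarrow> filterlim (\<lambda>t. f (1 - t)) F (at_right 0)"
  using filterlim_at_left_to_right[of f F 1] filterlim_at_right_to_0[of "\<lambda>x. f (- x)" F "- 1"] by simp

section \<open>The maximization problem\<close>

theorem theoremB:
  fixes q A :: real
  assumes "q > 1" and "A > 0"
  defines "\<alpha> \<equiv> q / (q - 1)"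
      and "c \<equiv> (1/2) * (A * (4 * q - 2) / q) powr q"
  shows "\<exists>VA.
     admissible q A VA \<and>
     (\<forall>V. admissible q A V \<longrightarrow> det_T V \<le> det_T VA) \<and>
     (\<forall>V. admissible q A V \<and> det_T V = det_T VA \<longrightarrow>
          (AE t in lborel. t \<in> {0..1} \<longrightarrow> V t = VA t)) \<and>
     (\<exists>!H. H > c \<and> (\<exists>\<Psi>. psi_sol \<alpha> H c \<Psi> \<and>
            (\<forall>t\<in>{0..1}. VA t = q / (4 * q - 2) * \<Psi> t powr (1 / (q - 1))))) \<and>
     (\<forall>H \<Psi>. H > c \<and> psi_sol \<alpha> H c \<Psi> \<and>
            (\<forall>t\<in>{0..1}. VA t = q / (4 * q - 2) * \<Psi> t powr (1 / (q - 1)))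
            \<longrightarrow> (\<forall>t\<in>{0..1}. \<Psi> t \<ge> 0)) \<and>
     (\<forall>t\<in>{0..1}. VA (1 - t) = VA t) \<and>
     smooth_on {0<..<1} VA \<and>
     strict_mono_on {0..1/2} VA \<and>
     (q < 2 \<longrightarrow> (VA has_real_derivative 0) (at_right 0) \<and>
                 (VA has_real_derivative 0) (at_left 1)) \<and>
     (q = 2 \<longrightarrow> (\<exists>d>0. (VA has_real_derivative d) (at_right 0)) \<and>
                 (\<exists>d<0. (VA has_real_derivative d) (at_left 1))) \<and>
     (q > 2 \<longrightarrow> filterlim (\<lambda>t. (VA t - VA 0) / t) at_top (at_right 0) \<and>
                 filterlim (\<lambda>t. (VA t - VA 1) / (t - 1)) at_bot (at_left 1))"
proof -
  have \<alpha>: "\<alpha> > 1" "\<alpha> - 1 = 1 / (q - 1)" using \<open>q > 1\<close> by (auto simp: \<alpha>_def field_simps)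
  define k where "k = q / (4 * q - 2)"
  have k: "k > 0" using \<open>q > 1\<close> by (simp add: k_def)
  have c2: "2 * c = (A / k) powr q" by (simp add: c_def k_def)
  have "2 * c > 0" unfolding c2 using k \<open>A > 0\<close> by simp
  then have c: "c > 0" by simp
  define r where "r = 1 / (q - 1)"
  have r: "r > 0" "\<alpha> = 1 + r" using \<open>q > 1\<close> \<alpha> by (auto simp: r_def)
  have rq: "r * (q - 1) = 1" "r * q = \<alpha>" using \<open>q > 1\<close> by (auto simp: r_def \<alpha>_def)
  obtain H \<Psi> \<Psi>' where H: "H > c"
    and D: "\<And>t. (\<Psi> has_real_derivative \<Psi>' t) (at t)"
    and D': "\<And>t. (\<Psi>' has_real_derivative max 0 (\<Psi> t) powr \<alpha> - 2 * H) (at t)"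
    and \<Psi>0: "\<Psi> 0 = 0" and \<Psi>'0: "\<Psi>' 0 = H - c" and \<Psi>'1: "\<Psi>' 1 = - (H - c)"
    and sym: "\<And>t. \<Psi> (1 - t) = \<Psi> t" and mono: "strict_mono_on {0..1/2} \<Psi>"
    and pos: "\<And>t. t \<in> {0<..<1} \<Longrightarrow> \<Psi> t > 0" and \<Psi>'le: "\<And>t. t \<in> {0..1} \<Longrightarrow> \<Psi>' t \<le> H - c"
    and energy: "\<And>t. t \<in> {0..1} \<Longrightarrow> (\<Psi>' t)\<^sup>2 = (H - c)\<^sup>2 - 4 * H * \<Psi> t + 2 * \<Psi> t powr (\<alpha> + 1) / (\<alpha> + 1)"
    using psi_profile_exists[OF \<alpha>(1) c] by blast
  have \<Psi>1: "\<Psi> 1 = 0" using sym[of 0] \<Psi>0 by simp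
  have nonneg: "\<Psi> t \<ge> 0" if "t \<in> {0..1}" for t
  proof -
    have "t = 0 \<or> t = 1 \<or> t \<in> {0<..<1}" using that by auto
    then show ?thesis using \<Psi>0 \<Psi>1 pos[of t] by (auto simp: less_imp_le)
  qed
  note Dw = has_field_derivative_at_within[OF D]
  have D'abs: "(\<Psi>' has_real_derivative \<bar>\<Psi> t\<bar> powr \<alpha> - 2 * H) (at t within S)" if "t \<in> {0..1}" for t S
    using has_field_derivative_at_within[OF D', of t S] nonneg[OF that] by simp
  have cont\<Psi>: "continuous_on S \<Psi>" for S
    using DERIV_isCont[OF D] by (simp add: continuous_at_imp_continuous_on)
  have cont\<Psi>': "continuous_on S \<Psi>'" for S
    using DERIV_isCont[OF D'] by (simp add: continuous_at_imp_continuous_on)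
  have sol: "psi_sol \<alpha> H c \<Psi>"
    unfolding psi_sol_def using Dw D'abs \<Psi>0 \<Psi>'0 by (intro exI[of _ \<Psi>']) auto
  define VA where "VA = (\<lambda>t. k * \<Psi> t powr r)"
  have VA_nonneg: "VA t \<ge> 0" for t using k by (simp add: VA_def)
  have contVA: "continuous_on {0..1} VA"
    unfolding VA_def using nonneg r by (intro continuous_intros continuous_on_powr' cont\<Psi>) auto
  have VA0: "VA 0 = 0" and VA1: "VA 1 = 0" by (simp_all add: VA_def \<Psi>0 \<Psi>1)
  have VAsym: "VA (1 - t) = VA t" for t by (simp add: VA_def sym)
  have VAq: "VA t powr q = k powr q * \<Psi> t powr \<alpha>" for t
    using k by (simp add: VA_def powr_mult powr_powr rq)
  have norm: "(LINT t:{0..1}|lborel. VA t powr q) = A powr q"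
  proof -
    \<comment> \<open>Integrating the equation over [0,1]: the end slopes \<open>H - c\<close> and
      \<open>- (H - c)\<close> leave \<open>2 c\<close> for the integral of
      \<open>\<Psi> powr \<alpha>\<close>, whatever the value of \<open>H\<close>.\<close>
    have "((\<lambda>t. \<bar>\<Psi> t\<bar> powr \<alpha> - 2 * H) has_integral (\<Psi>' 1 - \<Psi>' 0)) {0..1}"
      by (intro fundamental_theorem_of_calculus)
         (auto simp: has_real_derivative_iff_has_vector_derivative[symmetric] intro!: D'abs)
    then have "((\<lambda>t. \<bar>\<Psi> t\<bar> powr \<alpha> - 2 * H + 2 * H) has_integral (\<Psi>' 1 - \<Psi>' 0 + 2 * H)) {0..1}"
      using has_integral_const_real[of "2 * H" 0 1] by (intro has_integral_add) auto
    then have "((\<lambda>t. k powr q * \<bar>\<Psi> t\<bar> powr \<alpha>) has_integral k powr q * (2 * c)) {0..1}"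
      by (intro has_integral_mult_right) (simp add: \<Psi>'0 \<Psi>'1)
    then have "integral {0..1} (\<lambda>t. k powr q * \<bar>\<Psi> t\<bar> powr \<alpha>) = k powr q * (2 * c)" by (rule integral_unique)
    moreover have "integral {0..1} (\<lambda>t. k powr q * \<bar>\<Psi> t\<bar> powr \<alpha>) = integral {0..1} (\<lambda>t. VA t powr q)"
      by (intro integral_cong) (simp add: VAq nonneg)
    moreover have "set_integrable lborel {0..1} (\<lambda>t. VA t powr q)"
      using \<open>q > 1\<close> VA_nonneg
      by (intro borel_integrable_atLeastAtMost' continuous_on_powr' contVA continuous_on_const) auto
    moreover have "k powr q * (2 * c) = A powr q"
      unfolding c2 using k \<open>A > 0\<close> by (simp add: powr_divide)
    ultimately show ?thesis by (simp add: set_borel_integral_eq_integral)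
  qed
  have VA_adm: "admissible q A VA"
  proof -
    have "set_borel_measurable lborel {0..1} VA"
      using borel_measurable_continuous_on_indicator[OF _ contVA] by (simp add: set_borel_measurable_def)
    moreover have "set_integrable lborel {0..1} (\<lambda>t. VA t powr q)"
      using \<open>q > 1\<close> VA_nonneg
      by (intro borel_integrable_atLeastAtMost' continuous_on_powr' contVA continuous_on_const) auto
    moreover have "Lq_norm01 q VA = A"
      using \<open>q > 1\<close> \<open>A > 0\<close> VA_nonneg norm by (simp add: Lq_norm01_def powr_powr)
    ultimately show ?thesis using VA_nonneg by (simp add: admissible_def Lq_on01_def)
  qed
  obtain z where z: "y_sol VA z"
    using y_sol_exists[OF borel_integrable_atLeastAtMost'[OF contVA]] by blast
  have riccati: "2 * \<Psi> t * (1 + integral {0..t} (\<lambda>s. VA s * z s)) = (\<Psi>' t + (H - c)) * z t" if "t \<in> {0..1}" for t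
  proof (rule riccati_of_first_integral[OF contVA z Dw D'abs \<Psi>0 _ \<Psi>'le _ that])
    fix s :: real assume s: "s \<in> {0..1}"
    define P where "P = \<Psi> s powr (\<alpha> + 1)"
    have 1: "\<Psi> s * \<bar>\<Psi> s\<bar> powr \<alpha> = P"
      using powr_mult_base[of "\<Psi> s" \<alpha>] nonneg[OF s] by (simp add: P_def add.commute)
    have "VA s * (\<Psi> s)\<^sup>2 = k * (\<Psi> s powr r * (\<Psi> s * \<Psi> s))" by (simp add: VA_def power2_eq_square)
    also have "\<Psi> s powr r * (\<Psi> s * \<Psi> s) = P"
      using powr_mult_base[of "\<Psi> s" r] powr_mult_base[of "\<Psi> s" "1 + r"] nonneg[OF s]
      by (simp add: P_def r(2) ac_simps)
    finally have 2: "VA s * (\<Psi> s)\<^sup>2 = k * P" .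
    \<comment> \<open>Here the value of \<open>k\<close> enters: it makes the three multiples of
      \<open>P\<close> cancel.\<close>
    have "\<alpha> + 1 = (2 * q - 1) / (q - 1)" using \<open>q > 1\<close> by (simp add: \<alpha>_def field_simps)
    then have "2 * \<alpha> / (\<alpha> + 1) = 2 * q / (2 * q - 1)" using \<open>q > 1\<close> by (simp add: \<alpha>_def)
    also have "\<dots> = 4 * k" using \<open>q > 1\<close> by (simp add: k_def field_simps)
    finally have "4 * k = 2 * \<alpha> / (\<alpha> + 1)" ..
    then have 3: "2 * P / (\<alpha> + 1) - 2 * P + 4 * k * P = 0" using \<alpha>(1) by (simp add: field_simps)
    have "(\<Psi>' s)\<^sup>2 - 2 * \<Psi> s * (\<bar>\<Psi> s\<bar> powr \<alpha> - 2 * H) + 4 * VA s * (\<Psi> s)\<^sup>2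
        = (\<Psi>' s)\<^sup>2 - 2 * (\<Psi> s * \<bar>\<Psi> s\<bar> powr \<alpha>) + 4 * H * \<Psi> s + 4 * (VA s * (\<Psi> s)\<^sup>2)"
      by (simp add: algebra_simps)
    also have "\<dots> = (H - c)\<^sup>2"
      unfolding 1 2 energy[OF s] P_def[symmetric] using 3 by simp
    finally show "(\<Psi>' s)\<^sup>2 - 2 * \<Psi> s * (\<bar>\<Psi> s\<bar> powr \<alpha> - 2 * H) + 4 * VA s * (\<Psi> s)\<^sup>2 = (H - c)\<^sup>2" .
  qed (use pos in auto)
  have \<Psi>VA: "\<Psi> t = k powr (1 - q) * VA t powr (q - 1)" if "t \<in> {0..1}" for t
  proof -
    have "VA t powr (q - 1) = k powr (q - 1) * \<Psi> t"
      using k nonneg[OF that] by (simp add: VA_def powr_mult powr_powr rq)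
    then show ?thesis using k by (simp add: mult.assoc[symmetric] powr_add[symmetric])
  qed
  have kq: "k powr (1 - q) > 0" using k by simp
  have Hc: "H - c > 0" using H by simp
  note maximal = det_T_maximal[OF \<open>q > 1\<close> kq contVA VA_nonneg norm z Dw cont\<Psi>' \<Psi>0 \<Psi>1 \<Psi>'0[symmetric] Hc \<Psi>VA riccati]
  \<comment> \<open>Off the nonnegative reals \<open>powr\<close> does not show the sign of its
    base, so at first only the zeros of \<Phi> are read off \<open>VA\<close>. As \<Phi> starts with
    slope \<open>H2 - c > 0\<close> and can vanish only where \<Psi> does, it is positive inside;
    then it equals \<Psi> there, and the slopes at 0 give \<open>H2 = H\<close>.\<close>
  have agree: "H2 = H \<and> (\<forall>t\<in>{0..1}. \<Phi> t \<ge> 0)"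
    if H2: "H2 > c" and \<Phi>: "psi_sol \<alpha> H2 c \<Phi>" and VA\<Phi>: "\<forall>t\<in>{0..1}. VA t = q / (4 * q - 2) * \<Phi> t powr (1 / (q - 1))" for H2 \<Phi>
  proof -
    obtain \<Phi>' where D\<Phi>: "\<And>t. t \<in> {0..1} \<Longrightarrow> (\<Phi> has_real_derivative \<Phi>' t) (at t within {0..1})"
      and \<Phi>0: "\<Phi> 0 = 0" and \<Phi>'0: "\<Phi>' 0 = H2 - c"
      using \<Phi> unfolding psi_sol_def by blast
    have cont: "continuous_on {0..1} \<Phi>"
      using D\<Phi> DERIV_continuous unfolding continuous_on_eq_continuous_within by blast
    have eq: "\<Phi> t powr r = \<Psi> t powr r" if "t \<in> {0..1}" for t
      using VA\<Phi> that k unfolding VA_def k_def[symmetric] r_def[symmetric] by auto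
    have zero_iff: "\<Phi> t = 0 \<longleftrightarrow> \<Psi> t = 0" if "t \<in> {0..1}" for t
      using eq[OF that] by (metis powr_eq_0_iff)
    have lim\<Phi>: "((\<lambda>t. \<Phi> t / t) \<longlongrightarrow> H2 - c) (at_right 0)"
      using D\<Phi>[of 0] \<Phi>'0 \<Phi>0 by (intro tendsto_div_at_right_0) auto
    have pos\<Phi>: "\<Phi> t > 0" if t: "t \<in> {0<..<1}" for t
    proof (rule ccontr)
      assume "\<not> \<Phi> t > 0"
      moreover have "\<forall>\<^sub>F s in at_right 0. \<Phi> s / s > 0" using order_tendstoD(1)[OF lim\<Phi>, of 0] H2 by simp
      moreover have "\<forall>\<^sub>F s in at_right 0. s \<in> {0<..<t}" using t by (intro eventually_at_right_real) auto
      ultimately have "\<forall>\<^sub>F s in at_right 0. \<Phi> s / s > 0 \<and> s \<in> {0<..<t}" by (intro eventually_conj)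
      then obtain s where s: "\<Phi> s / s > 0" "s \<in> {0<..<t}"
        using eventually_happens[of _ "at_right (0::real)"] by force
      then have "\<Phi> s > 0" by (simp add: zero_less_divide_iff)
      moreover have "continuous_on {s..t} \<Phi>" by (rule continuous_on_subset[OF cont]) (use s t in auto)
      ultimately obtain u where u: "s \<le> u" "u \<le> t" "\<Phi> u = 0"
        using IVT2'[of \<Phi> t 0 s] \<open>\<not> \<Phi> t > 0\<close> s by auto
      then have "u \<in> {0<..<1}" using s t by auto
      then show False using pos[of u] zero_iff[of u] u by auto
    qed
    have nonneg\<Phi>: "\<Phi> t \<ge> 0" if "t \<in> {0..1}" for t
    proof -
      have "t = 0 \<or> t = 1 \<or> t \<in> {0<..<1}" using that by auto
      then show ?thesis using \<Phi>0 zero_iff[of 1] \<Psi>1 pos\<Phi>[of t] by (auto simp: less_imp_le)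
    qed
    have "\<Phi> t = \<Psi> t" if "t \<in> {0<..<1}" for t
    proof -
      have "(\<Phi> t powr r) powr (q - 1) = (\<Psi> t powr r) powr (q - 1)" using eq[of t] that by simp
      then show ?thesis using pos\<Phi>[OF that] pos[OF that] by (simp add: powr_powr rq)
    qed
    then have "\<forall>\<^sub>F t in at_right 0. \<Phi> t / t = \<Psi> t / t"
      using eventually_at_right_real[of 0 "1::real"] by (auto elim!: eventually_mono)
    then have "((\<lambda>t. \<Psi> t / t) \<longlongrightarrow> H2 - c) (at_right 0)"
      using lim\<Phi> by (rule Lim_transform_eventually[rotated])
    moreover have "((\<lambda>t. \<Psi> t / t) \<longlongrightarrow> H - c) (at_right 0)"
      using Dw[of 0 "{0..1}"] \<Psi>'0 \<Psi>0 by (intro tendsto_div_at_right_0) auto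
    ultimately have "H2 - c = H - c" by (intro tendsto_unique[of "at_right (0::real)"]) auto
    then show ?thesis using nonneg\<Phi> by simp
  qed
  have lim\<Psi>: "((\<lambda>t. \<Psi> t / t) \<longlongrightarrow> H - c) (at_right 0)"
    using Dw[of 0 "{0..1}"] \<Psi>'0 \<Psi>0 by (intro tendsto_div_at_right_0) auto
  have right: "(VA has_real_derivative d) (at_right 0) \<longleftrightarrow> ((\<lambda>t. k * (\<Psi> t powr r / t)) \<longlongrightarrow> d) (at_right 0)" for d
    by (simp add: has_field_derivative_iff VA0) (simp add: VA_def)
  have left: "(VA has_real_derivative - d) (at_left 1)" if "(VA has_real_derivative d) (at_right 0)" for d
  proof -
    have "((\<lambda>t. - (VA t / t)) \<longlongrightarrow> - d) (at_right 0)"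
      using that by (intro tendsto_minus) (simp add: has_field_derivative_iff VA0)
    then show ?thesis
      unfolding has_field_derivative_iff filterlim_at_left_1_iff by (simp add: VAsym VA1)
  qed
  have q1: "(VA has_real_derivative 0) (at_right 0)" if "q < 2"
  proof -
    have "r > 1" using that \<open>q > 1\<close> by (simp add: r_def)
    from tendsto_mult_left[OF tendsto_powr_quotient_0[OF lim\<Psi> Hc this], of k] show ?thesis
      unfolding right by simp
  qed
  have q2: "(VA has_real_derivative k * (H - c)) (at_right 0)" if "q = 2"
  proof -
    have "r = 1" using that by (simp add: r_def)
    have "\<forall>\<^sub>F t in at_right 0. k * (\<Psi> t / t) = k * (\<Psi> t powr r / t)"
      using eventually_at_right_real[of 0 "1::real"] unfolding \<open>r = 1\<close>
      by (auto elim!: eventually_mono simp: pos less_imp_le)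
    with tendsto_mult_left[OF lim\<Psi>, of k] show ?thesis
      unfolding right by (rule Lim_transform_eventually)
  qed
  have q3: "filterlim (\<lambda>t. VA t / t) at_top (at_right 0)" if "q > 2"
  proof -
    have "r < 1" using that by (simp add: r_def)
    from filterlim_tendsto_pos_mult_at_top[OF tendsto_const k filterlim_powr_quotient_at_top[OF lim\<Psi> Hc this]]
    show ?thesis by (simp add: VA_def)
  qed
  have q3': "filterlim (\<lambda>t. (VA t - VA 1) / (t - 1)) at_bot (at_left 1)" if "q > 2"
    using q3[OF that] unfolding filterlim_at_left_1_iff by (simp add: VAsym VA1 filterlim_uminus_at_top)
  have smooth: "smooth_on {0<..<1} VA"
    unfolding VA_def
  proof (rule smooth_on_powr_of_ode_solution)
    show "(\<Psi>' has_real_derivative \<Psi> t powr \<alpha> - 2 * H) (at t)" if "t \<in> {0<..<1}" for t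
      using D'[of t] pos[OF that] by simp
  qed (use D pos in auto)
  have mono_VA: "strict_mono_on {0..1/2} VA"
  proof (rule strict_mono_onI)
    fix s t :: real assume "s \<in> {0..1/2}" "t \<in> {0..1/2}" "s < t"
    then have "\<Psi> s < \<Psi> t" "\<Psi> s \<ge> 0" using strict_mono_onD[OF mono] nonneg[of s] by auto
    then show "VA s < VA t" unfolding VA_def using k r by (intro mult_strict_left_mono powr_less_mono2) auto
  qed
  have VA_eq: "VA t = q / (4 * q - 2) * \<Psi> t powr (1 / (q - 1))" for t
    by (simp add: VA_def k_def r_def)
  show ?thesis
  proof (intro exI[of _ VA] conjI)
    show "\<exists>!H. H > c \<and> (\<exists>\<Psi>. psi_sol \<alpha> H c \<Psi> \<and>
            (\<forall>t\<in>{0..1}. VA t = q / (4 * q - 2) * \<Psi> t powr (1 / (q - 1))))"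
      using H sol VA_eq agree by (intro ex1I[of _ H]) blast+
    show "q = 2 \<longrightarrow> (\<exists>d>0. (VA has_real_derivative d) (at_right 0)) \<and>
                 (\<exists>d<0. (VA has_real_derivative d) (at_left 1))"
    proof (intro impI conjI)
      assume q: "q = 2"
      have "k * (H - c) > 0" using k Hc by simp
      then show "\<exists>d>0. (VA has_real_derivative d) (at_right 0)" "\<exists>d<0. (VA has_real_derivative d) (at_left 1)"
        using q2[OF q] left[OF q2[OF q]] by (blast, intro exI[of _ "- (k * (H - c))"]) simp
    qed
    show "q < 2 \<longrightarrow> (VA has_real_derivative 0) (at_right 0) \<and> (VA has_real_derivative 0) (at_left 1)"
      using q1 left[of 0] by simp
    show "q > 2 \<longrightarrow> filterlim (\<lambda>t. (VA t - VA 0) / t) at_top (at_right 0) \<and>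
                 filterlim (\<lambda>t. (VA t - VA 1) / (t - 1)) at_bot (at_left 1)"
      using q3 q3' by (simp add: VA0)
  qed (use VA_adm maximal agree VAsym smooth mono_VA in blast)+
qed

end
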